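(* Let $\omega=(\omega_n)$ be an increasing sequence of algebra weights on $\mathbb R^+$ such that, for every $n\in\mathbb N$, $\omega_n(t)\to\infty$ as $t\to\infty$, $\lim_{t\to\infty}\omega_n(t)^{1/t}=1$, and $\sup_{t\in\mathbb R^+}\omega_{n+1}(t)/\omega_n(t)=\infty$. Then there are no non-zero weakly compact derivations on $A(\omega)$.
   Context: All spaces are complex and $\mathbb R^+=[0,\infty)$. An algebra weight on $\mathbb R^+$ is a positive Borel function $w$ on $\mathbb R^+$ such that $w$ and $1/w$ are locally bounded, $w$ is right continuous, $w(t+s)\le w(t)w(s)$ for all $t,s\in\mathbb R^+$, and $w(0)=1$. For an algebra weight $w$, $L^1(w)$ is the Banach algebra (under convolution $(f*g)(t)=\int_0^tf(s)g(t-s)\,ds$) of (equivalence classes of) functions $f$ on $\mathbb R^+$ with $\|f\|_w=\int_0^\infty|f(t)|w(t)\,dt<\infty$. For a sequence $\omega=(\omega_n)$ as in the statement, $A(\omega)=\bigcap_nL^1(\omega_n)$, equipped with the increasing sequence of norms $\|\cdot\|_n=\|\cdot\|_{\omega_n}$, is a Fréchet algebra under convolution. A derivation on $A(\omega)$ is a linear map $D:A(\omega)\to A(\omega)$ with $D(f*g)=D(f)*g+f*D(g)$ for all $f,g$ (it is known that such maps are automatically continuous). A linear operator between Fréchet spaces is weakly compact if it maps some neighbourhood of $0$ to a weakly relatively compact set. *)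

theory Defs
  imports "HOL-Analysis.Analysis"
begin

section \<open>Algebra weights on the half-line\<close>

definition locally_bounded_on :: "'a::topological_space set \<Rightarrow> ('a \<Rightarrow> 'b::metric_space) \<Rightarrow> bool" where
  "locally_bounded_on S f \<longleftrightarrow> (\<forall>x\<in>S. \<exists>U. open U \<and> x \<in> U \<and> bounded (f ` (S \<inter> U)))"

text \<open>A weight is a function on \<open>[0,\<infinity>)\<close>; its values at negative arguments are irrelevant.\<close>

definition algebra_weight :: "(real \<Rightarrow> real) \<Rightarrow> bool" where
  "algebra_weight w \<longleftrightarrow>
     w \<in> borel_measurable (restrict_space borel {0..}) \<and>
     (\<forall>t\<ge>0. w t > 0) \<and>
     locally_bounded_on {0..} w \<and>
     locally_bounded_on {0..} (\<lambda>t. 1 / w t) \<and>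
     (\<forall>t\<ge>0. continuous (at_right t) w) \<and>
     (\<forall>t\<ge>0. \<forall>s\<ge>0. w (t + s) \<le> w t * w s) \<and>
     w 0 = 1"


section \<open>Equivalence classes of measurable functions on the half-line\<close>

abbreviation lborel_plus :: "real measure" where
  "lborel_plus \<equiv> restrict_space lborel {0..}"

definition ae_eq :: "(real \<Rightarrow> complex) \<Rightarrow> (real \<Rightarrow> complex) \<Rightarrow> bool" where
  "ae_eq f g \<longleftrightarrow> f \<in> borel_measurable lborel_plus \<and> g \<in> borel_measurable lborel_plus \<and>
     (AE t in lborel_plus. f t = g t)"

lemma part_equivp_ae_eq: "part_equivp ae_eq"
proof (rule part_equivpI)
  show "\<exists>x. ae_eq x x"
    by (rule exI[of _ "\<lambda>_. 0"]) (simp add: ae_eq_def)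
  show "symp ae_eq"
    by (auto simp: symp_def ae_eq_def eq_commute)
  show "transp ae_eq"
  proof (rule transpI)
    fix f g h
    assume fg: "ae_eq f g" and gh: "ae_eq g h"
    then have "AE t in lborel_plus. f t = g t" "AE t in lborel_plus. g t = h t"
      by (simp_all add: ae_eq_def)
    then have "AE t in lborel_plus. f t = h t"
      by eventually_elim simp
    with fg gh show "ae_eq f h"
      by (simp add: ae_eq_def)
  qed
qed

text \<open>No integrability is imposed here, so that one type serves all weights; the spaces
  \<open>L\<^sup>1(w)\<close> and \<open>A(\<omega>)\<close> are subsets of it. Borel and Lebesgue measurable functions
  give the same classes.\<close>

quotient_type halfline_fun = "real \<Rightarrow> complex" / partial: ae_eq
  by (rule part_equivp_ae_eq)

instantiation halfline_fun :: ab_group_add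
begin

lift_definition zero_halfline_fun :: halfline_fun is "\<lambda>_. 0"
  by (simp add: ae_eq_def)

lift_definition plus_halfline_fun :: "halfline_fun \<Rightarrow> halfline_fun \<Rightarrow> halfline_fun"
  is "\<lambda>f g t. f t + g t"
  by (auto simp: ae_eq_def elim: eventually_elim2)

lift_definition minus_halfline_fun :: "halfline_fun \<Rightarrow> halfline_fun \<Rightarrow> halfline_fun"
  is "\<lambda>f g t. f t - g t"
  by (auto simp: ae_eq_def elim: eventually_elim2)

lift_definition uminus_halfline_fun :: "halfline_fun \<Rightarrow> halfline_fun"
  is "\<lambda>f t. - f t"
  by (auto simp: ae_eq_def)

instance
  by standard (transfer; simp add: ae_eq_def algebra_simps)+

end

lift_definition cscale :: "complex \<Rightarrow> halfline_fun \<Rightarrow> halfline_fun"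
  is "\<lambda>c f t. c * f t"
  by (auto simp: ae_eq_def elim: eventually_mono)

lemma set_integral_convolution_eq:
  "(LINT s:{0..t}|lborel. f s * g (t - s)) =
   (\<integral>s. (indicator {0..} s *\<^sub>R f s) * (indicator {0..} (t - s) *\<^sub>R g (t - s)) \<partial>lborel)"
  for f g :: "real \<Rightarrow> complex"
  unfolding set_lebesgue_integral_def
  by (rule Bochner_Integration.integral_cong) (auto simp: indicator_def)

lemma borel_measurable_convolution:
  fixes f g :: "real \<Rightarrow> complex"
  assumes "f \<in> borel_measurable lborel_plus" "g \<in> borel_measurable lborel_plus"
  shows "(\<lambda>t. LINT s:{0..t}|lborel. f s * g (t - s)) \<in> borel_measurable lborel_plus"
proof -
  have [measurable]: "(\<lambda>t. indicator {0..} t *\<^sub>R f t) \<in> borel_measurable borel"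
    "(\<lambda>t. indicator {0..} t *\<^sub>R g t) \<in> borel_measurable borel"
    using assms by (simp_all add: borel_measurable_restrict_space_iff)
  have "(\<lambda>t. \<integral>s. (indicator {0..} s *\<^sub>R f s) * (indicator {0..} (t - s) *\<^sub>R g (t - s)) \<partial>lborel)
      \<in> borel_measurable borel"
    by measurable
  then show ?thesis
    unfolding set_integral_convolution_eq
    by (intro measurable_restrict_space1) simp
qed

lemma AE_lborel_reflect:
  fixes P :: "real \<Rightarrow> bool"
  assumes "AE x in lborel. P x"
  shows "AE x in lborel. P (t - x)"
proof -
  have eq: "lborel = distr lborel borel (\<lambda>x. t - x)"
  proof -
    have "distr lborel borel (\<lambda>x. t - x) = distr (distr lborel borel uminus) borel ((+) t)"
      by (subst distr_distr) (auto simp: o_def)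
    then show ?thesis
      by (simp add: lborel_distr_uminus lborel_distr_plus)
  qed
  from assms have "AE x in distr lborel borel (\<lambda>x. t - x). P x"
    unfolding eq[symmetric] .
  then show ?thesis
    by (rule AE_distrD[rotated]) simp
qed

text \<open>At arguments \<open>t\<close> where the integrand is not integrable the Bochner integral is \<open>0\<close>;
  for two elements of \<open>L\<^sup>1(w)\<close> these form a null set.\<close>

lift_definition convolution :: "halfline_fun \<Rightarrow> halfline_fun \<Rightarrow> halfline_fun" (infixl "\<star>" 70)
  is "\<lambda>f g t. LINT s:{0..t}|lborel. f s * g (t - s)"
proof -
  fix f f' g g' :: "real \<Rightarrow> complex"
  assume ff: "ae_eq f f'" and gg: "ae_eq g g'"
  have meas: "f \<in> borel_measurable lborel_plus" "f' \<in> borel_measurable lborel_plus"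
     "g \<in> borel_measurable lborel_plus" "g' \<in> borel_measurable lborel_plus"
    using ff gg by (simp_all add: ae_eq_def)
  have [measurable]: "(\<lambda>t. indicator {0..} t *\<^sub>R f t) \<in> borel_measurable borel"
    "(\<lambda>t. indicator {0..} t *\<^sub>R f' t) \<in> borel_measurable borel"
    "(\<lambda>t. indicator {0..} t *\<^sub>R g t) \<in> borel_measurable borel"
    "(\<lambda>t. indicator {0..} t *\<^sub>R g' t) \<in> borel_measurable borel"
    using meas by (simp_all add: borel_measurable_restrict_space_iff)
  have 1: "AE s in lborel. 0 \<le> s \<longrightarrow> f s = f' s" and 2: "AE s in lborel. 0 \<le> s \<longrightarrow> g s = g' s"
    using ff gg by (simp_all add: ae_eq_def AE_restrict_space_iff)
  have "(LINT s:{0..t}|lborel. f s * g (t - s)) = (LINT s:{0..t}|lborel. f' s * g' (t - s))" for t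
    unfolding set_integral_convolution_eq
  proof (rule integral_cong_AE)
    show "AE s in lborel. (indicator {0..} s *\<^sub>R f s) * (indicator {0..} (t - s) *\<^sub>R g (t - s)) =
        (indicator {0..} s *\<^sub>R f' s) * (indicator {0..} (t - s) *\<^sub>R g' (t - s))"
      using 1 AE_lborel_reflect[OF 2, of t] by eventually_elim (auto simp: indicator_def)
  qed measurable
  with meas show "ae_eq (\<lambda>t. LINT s:{0..t}|lborel. f s * g (t - s))
      (\<lambda>t. LINT s:{0..t}|lborel. f' s * g' (t - s))"
    by (simp add: ae_eq_def borel_measurable_convolution)
qed


section \<open>The algebras \<open>L\<^sup>1(w)\<close> and \<open>A(\<omega>)\<close>\<close>

lift_definition wnorm :: "(real \<Rightarrow> real) \<Rightarrow> halfline_fun \<Rightarrow> ennreal"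
  is "\<lambda>w f. \<integral>\<^sup>+t. ennreal (cmod (f t) * w t) \<partial>lborel_plus"
  by (rule nn_integral_cong_AE) (auto simp: ae_eq_def elim: eventually_mono)

definition L1w :: "(real \<Rightarrow> real) \<Rightarrow> halfline_fun set" where
  "L1w w = {F. wnorm w F < \<infinity>}"

definition Aw :: "(nat \<Rightarrow> real \<Rightarrow> real) \<Rightarrow> halfline_fun set" where
  "Aw \<omega> = (\<Inter>n. L1w (\<omega> n))"

text \<open>The Frechet topology given by all the norms together: open balls of each norm form a
  subbase.\<close>

definition Aw_topology :: "(nat \<Rightarrow> real \<Rightarrow> real) \<Rightarrow> halfline_fun topology" where
  "Aw_topology \<omega> = topology_generated_by
     {{G \<in> Aw \<omega>. wnorm (\<omega> n) (G - F) < ennreal e} | n F e. F \<in> Aw \<omega> \<and> 0 < e}"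


section \<open>Weak topology, weakly compact operators, derivations\<close>

text \<open>There is no type class of complex vector spaces, so scalar multiplications are passed
  explicitly; a subspace is represented by the \<open>topspace\<close> of its topology.\<close>

definition linear_map_on ::
  "(complex \<Rightarrow> 'a \<Rightarrow> 'a) \<Rightarrow> (complex \<Rightarrow> 'b \<Rightarrow> 'b) \<Rightarrow> 'a set \<Rightarrow>
   ('a::ab_group_add \<Rightarrow> 'b::ab_group_add) \<Rightarrow> bool" where
  "linear_map_on s\<^sub>1 s\<^sub>2 S f \<longleftrightarrow>
     (\<forall>x\<in>S. \<forall>y\<in>S. f (x + y) = f x + f y) \<and> (\<forall>c. \<forall>x\<in>S. f (s\<^sub>1 c x) = s\<^sub>2 c (f x))"

definition topological_dual ::
  "(complex \<Rightarrow> 'a \<Rightarrow> 'a) \<Rightarrow> 'a::ab_group_add topology \<Rightarrow> ('a \<Rightarrow> complex) set" where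
  "topological_dual sc X =
     {\<phi>. linear_map_on sc (*) (topspace X) \<phi> \<and> continuous_map X euclidean \<phi>}"

definition weak_topology ::
  "(complex \<Rightarrow> 'a \<Rightarrow> 'a) \<Rightarrow> 'a::ab_group_add topology \<Rightarrow> 'a topology" where
  "weak_topology sc X = topology_generated_by
     {{x \<in> topspace X. \<phi> x \<in> V} | \<phi> V. \<phi> \<in> topological_dual sc X \<and> open V}"

definition weakly_compact_map ::
  "'a::ab_group_add topology \<Rightarrow> (complex \<Rightarrow> 'b \<Rightarrow> 'b) \<Rightarrow> 'b::ab_group_add topology \<Rightarrow> ('a \<Rightarrow> 'b) \<Rightarrow> bool" where
  "weakly_compact_map X sc Y T \<longleftrightarrow>
     (\<exists>N U. openin X U \<and> 0 \<in> U \<and> U \<subseteq> N \<and> N \<subseteq> topspace X \<and>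
        compactin (weak_topology sc Y) (weak_topology sc Y closure_of (T ` N)))"

definition derivation_on :: "halfline_fun set \<Rightarrow> (halfline_fun \<Rightarrow> halfline_fun) \<Rightarrow> bool" where
  "derivation_on A D \<longleftrightarrow>
     D ` A \<subseteq> A \<and> linear_map_on cscale cscale A D \<and>
     (\<forall>F\<in>A. \<forall>G\<in>A. D (F \<star> G) = D F \<star> G + F \<star> D G)"

end

theory Submission
  imports Defs
begin

text \<open>
  Weak compactness of a derivation \<open>D\<close> is only used to bound it in a single norm: a weakly relatively
  compact set is weakly bounded, hence bounded in each norm by the uniform boundedness principle,
  and a neighbourhood of \<open>0\<close> contains a ball of one norm \<open>\<parallel>\<cdot>\<parallel>\<^sub>m\<close>. So \<open>\<parallel>D f\<parallel>\<^sub>m \<le> K \<parallel>f\<parallel>\<^sub>m\<close>.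

  Submultiplicativity and \<open>\<omega>\<^sub>m(t) \<rightarrow> \<infinity>\<close> force \<open>\<omega>\<^sub>m \<ge> 1\<close>, so that the Laplace transform at every
  \<open>k \<in> \<nat>\<close> is a character \<open>\<phi>\<close> continuous for \<open>\<parallel>\<cdot>\<parallel>\<^sub>m\<close>. As in the Singer--Wermer theorem, \<open>\<phi> \<circ> D = 0\<close>: if
  \<open>\<phi>(a) = 0\<close> then \<open>\<phi>(D\<^sup>n(a\<^sup>n)) = n! \<phi>(D a)\<^sup>n\<close>, while the left-hand side is at most \<open>(K \<parallel>a\<parallel>\<^sub>m)\<^sup>n\<close>; the
  general case follows by considering \<open>a * a - \<phi>(a) a\<close>. Finally Lerch's theorem gives \<open>D f = 0\<close>.
\<close>

section \<open>Bounded derivations and characters\<close>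

locale bounded_derivation =
  fixes A :: "'a::ab_group_add set" and mul :: "'a \<Rightarrow> 'a \<Rightarrow> 'a" and sc :: "complex \<Rightarrow> 'a \<Rightarrow> 'a"
    and N :: "'a \<Rightarrow> real" and D :: "'a \<Rightarrow> 'a" and K :: real
  assumes add_closed: "x \<in> A \<Longrightarrow> y \<in> A \<Longrightarrow> x + y \<in> A"
    and mul_closed: "x \<in> A \<Longrightarrow> y \<in> A \<Longrightarrow> mul x y \<in> A"
    and sc_closed: "x \<in> A \<Longrightarrow> sc c x \<in> A"
    and D_closed: "x \<in> A \<Longrightarrow> D x \<in> A"
    and D_add: "x \<in> A \<Longrightarrow> y \<in> A \<Longrightarrow> D (x + y) = D x + D y"
    and D_sc: "x \<in> A \<Longrightarrow> D (sc c x) = sc c (D x)"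
    and D_mul: "x \<in> A \<Longrightarrow> y \<in> A \<Longrightarrow> D (mul x y) = mul (D x) y + mul x (D y)"
    and N_nonneg: "0 \<le> N x"
    and N_mul: "x \<in> A \<Longrightarrow> y \<in> A \<Longrightarrow> N (mul x y) \<le> N x * N y"
    and N_D: "x \<in> A \<Longrightarrow> N (D x) \<le> K * N x"
    and K_nonneg: "0 \<le> K"
begin

lemma funpow_D_closed: "x \<in> A \<Longrightarrow> (D ^^ k) x \<in> A"
  by (induction k) (auto simp: D_closed)

lemma funpow_D_add: "x \<in> A \<Longrightarrow> y \<in> A \<Longrightarrow> (D ^^ k) (x + y) = (D ^^ k) x + (D ^^ k) y"
  by (induction k) (auto simp: D_add funpow_D_closed)

lemma N_funpow_D: "x \<in> A \<Longrightarrow> N ((D ^^ k) x) \<le> K ^ k * N x"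
proof (induction k)
  case (Suc k)
  have "N ((D ^^ Suc k) x) \<le> K * N ((D ^^ k) x)"
    using N_D[OF funpow_D_closed[OF Suc.prems]] by simp
  also have "\<dots> \<le> K * (K ^ k * N x)"
    by (intro mult_left_mono Suc K_nonneg)
  finally show ?case by (simp add: mult.assoc)
qed simp

text \<open>There is no unit to start from, so the index is shifted: this is \<open>a\<close> to the
  power \<open>Suc n\<close>.\<close>

primrec ppower :: "'a \<Rightarrow> nat \<Rightarrow> 'a" where
  "ppower a 0 = a"
| "ppower a (Suc n) = mul a (ppower a n)"

lemma ppower_closed: "a \<in> A \<Longrightarrow> ppower a n \<in> A"
  by (induction n) (auto simp: mul_closed)

lemma N_ppower: "a \<in> A \<Longrightarrow> N (ppower a n) \<le> N a ^ Suc n"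
proof (induction n)
  case (Suc n)
  have "N (ppower a (Suc n)) \<le> N a * N (ppower a n)"
    using N_mul[OF Suc.prems ppower_closed[OF Suc.prems]] by simp
  also have "\<dots> \<le> N a * N a ^ Suc n"
    by (intro mult_left_mono Suc N_nonneg)
  finally show ?case by simp
qed simp

end

section \<open>The Singer--Wermer argument for one bounded character\<close>

locale bounded_derivation_character = bounded_derivation +
  fixes \<phi> :: "'a \<Rightarrow> complex"
  assumes phi_add: "x \<in> A \<Longrightarrow> y \<in> A \<Longrightarrow> \<phi> (x + y) = \<phi> x + \<phi> y"
    and phi_sc: "x \<in> A \<Longrightarrow> \<phi> (sc c x) = c * \<phi> x"
    and phi_mul: "x \<in> A \<Longrightarrow> y \<in> A \<Longrightarrow> \<phi> (mul x y) = \<phi> x * \<phi> y"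
    and phi_bound: "x \<in> A \<Longrightarrow> cmod (\<phi> x) \<le> N x"
begin

text \<open>The Taylor series at z = 0 of the function sending z to \<open>\<phi>\<close> (exp(z D)
  x). Formally exp(z D) is an automorphism, so multiplicativity of this series packages the Leibniz
  formula for all iterates of \<open>D\<close>.\<close>

definition taylor :: "'a \<Rightarrow> complex fps" where
  "taylor x = Abs_fps (\<lambda>k. \<phi> ((D ^^ k) x) / fact k)"

lemma taylor_nth: "fps_nth (taylor x) k = \<phi> ((D ^^ k) x) / fact k"
  by (simp add: taylor_def)

lemma taylor_add: "x \<in> A \<Longrightarrow> y \<in> A \<Longrightarrow> taylor (x + y) = taylor x + taylor y"
  by (rule fps_ext) (simp add: taylor_nth funpow_D_add phi_add funpow_D_closed add_divide_distrib)

lemma taylor_D: "taylor (D x) = fps_deriv (taylor x)"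
  by (rule fps_ext) (simp add: taylor_nth funpow_swap1 field_simps del: of_nat_Suc)

text \<open>Coefficient \<open>Suc k\<close> is read off from coefficient \<open>k\<close> of the
  derivative, which by \<open>taylor_D\<close> and the product rule concerns the pairs
  \<open>(D x, y)\<close> and \<open>(x, D y)\<close>; hence the induction generalizes over
  \<open>x\<close> and \<open>y\<close>.\<close>

lemma taylor_mul:
  assumes "x \<in> A" "y \<in> A"
  shows "taylor (mul x y) = taylor x * taylor y"
proof -
  have "fps_nth (taylor (mul x y)) k = fps_nth (taylor x * taylor y) k" for k
    using assms
  proof (induction k arbitrary: x y)
    case 0
    then show ?case by (simp add: taylor_nth phi_mul)
  next
    case (Suc k)
    have "fps_nth (fps_deriv (taylor (mul x y))) k =
        fps_nth (taylor (mul (D x) y)) k + fps_nth (taylor (mul x (D y))) k"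
      using Suc.prems by (simp add: taylor_D[symmetric] D_mul taylor_add mul_closed D_closed del: fps_deriv_nth)
    also have "\<dots> = fps_nth (fps_deriv (taylor x * taylor y)) k"
      using Suc by (simp add: D_closed taylor_D del: fps_deriv_nth)
    finally show ?case
      by (simp del: of_nat_Suc fps_deriv_mult)
  qed
  then show ?thesis by (intro fps_ext) auto
qed

lemma taylor_ppower: "a \<in> A \<Longrightarrow> taylor (ppower a n) = taylor a ^ Suc n"
  by (induction n) (auto simp: taylor_mul ppower_closed)

text \<open>The factorial gained from the \<open>n\<close>-th derivative of an \<open>n\<close>-th power beats
  the geometric bound \<open>(K N(a))\<^sup>n\<close>.\<close>

lemma phi_D_eq_0_if_phi_eq_0:
  assumes a: "a \<in> A" and 0: "\<phi> a = 0"
  shows "\<phi> (D a) = 0"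
proof (rule ccontr)
  assume "\<phi> (D a) \<noteq> 0"
  then have r: "cmod (\<phi> (D a)) > 0" (is "?r > 0") by simp
  \<comment> \<open>With this ratio the coefficient estimate reads 1 \<le> M^n / n! for all n \<ge>
    1, which contradicts convergence of the exponential series.\<close>
  define M where "M = K * N a / ?r"
  have bound: "1 \<le> M ^ Suc n / fact (Suc n)" for n
  proof -
    \<comment> \<open>\<open>\<phi> a = 0\<close> removes the constant coefficient of
      \<open>taylor a\<close>, so its power \<open>Suc n\<close> starts at index
      \<open>Suc n\<close>, with the corresponding power of the linear coefficient
      \<open>\<phi> (D a)\<close>.\<close>
    have "fps_nth (taylor (ppower a n)) (Suc n) = \<phi> (D a) ^ Suc n"
      unfolding taylor_ppower[OF a]
      using startsby_zero_power_nth_same[of "taylor a" "Suc n"] 0 by (simp add: taylor_nth)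
    then have "?r ^ Suc n = cmod (\<phi> ((D ^^ Suc n) (ppower a n))) / fact (Suc n)"
      unfolding taylor_nth by (metis norm_divide norm_fact norm_power)
    also have "\<dots> \<le> (K ^ Suc n * N a ^ Suc n) / fact (Suc n)"
    proof (intro divide_right_mono)
      have "cmod (\<phi> ((D ^^ Suc n) (ppower a n))) \<le> N ((D ^^ Suc n) (ppower a n))"
        by (intro phi_bound funpow_D_closed ppower_closed a)
      also have "\<dots> \<le> K ^ Suc n * N (ppower a n)"
        by (intro N_funpow_D ppower_closed a)
      also have "\<dots> \<le> K ^ Suc n * N a ^ Suc n"
        by (intro mult_left_mono N_ppower a zero_le_power K_nonneg)
      finally show "cmod (\<phi> ((D ^^ Suc n) (ppower a n))) \<le> K ^ Suc n * N a ^ Suc n" .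
    qed simp
    finally have "?r ^ Suc n \<le> (K * N a) ^ Suc n / fact (Suc n)" by (simp add: power_mult_distrib del: power_Suc fact_Suc)
    then show ?thesis using zero_less_power[OF r, of "Suc n"]
      by (simp add: M_def power_divide field_simps del: power_Suc fact_Suc)
  qed
  have "(\<lambda>n. M ^ n / fact n) \<longlonglongrightarrow> 0"
    using summable_LIMSEQ_zero[OF summable_exp[of M]] by (simp add: divide_inverse mult.commute)
  then have "(\<lambda>n. M ^ Suc n / fact (Suc n)) \<longlonglongrightarrow> 0"
    by (rule LIMSEQ_Suc)
  then have "(1::real) \<le> 0"
    by (rule LIMSEQ_le_const) (use bound in blast)
  then show False by simp
qed

lemma phi_D_eq_0:
  assumes a: "a \<in> A"
  shows "\<phi> (D a) = 0"
proof (cases "\<phi> a = 0")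
  case False
  have aa: "mul a a \<in> A" "sc (- \<phi> a) a \<in> A" "D a \<in> A"
    using a by (auto intro: mul_closed sc_closed D_closed)
  \<comment> \<open>This element is in the kernel of \<open>\<phi>\<close>. Applying
    \<open>D\<close> and then \<open>\<phi>\<close> to it leaves 2 \<phi>(a) \<phi>(D a) - \<phi>(a)
    \<phi>(D a).\<close>
  have "\<phi> (D (mul a a + sc (- \<phi> a) a)) = 0"
    using a aa by (intro phi_D_eq_0_if_phi_eq_0 add_closed) (simp_all add: phi_add phi_mul phi_sc)
  then have "\<phi> a * \<phi> (D a) = 0"
    using a aa by (simp add: D_add D_mul D_sc phi_add phi_mul phi_sc add_closed mul_closed sc_closed D_closed)
  with False show ?thesis by simp
qed (use assms phi_D_eq_0_if_phi_eq_0 in auto)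

end

section \<open>Uniform boundedness in \<open>L\<^sup>1\<close>, Lerch's theorem, convolution integrals\<close>

text \<open>Uniform boundedness principle for functionals on bounded functions, proved by an
  explicit gliding hump: from an unbounded \<open>S\<close> a single test function \<open>h\<close>
  is built whose integrals against elements of \<open>S\<close> are unbounded. Test functions are
  bounded everywhere, so no classes of essentially bounded functions appear.\<close>

lemma L1_bounded_if_weakly_bounded:
  fixes S :: "('a \<Rightarrow> complex) set"
  assumes int: "\<And>f. f \<in> S \<Longrightarrow> integrable M f"
    and weak: "\<And>h. h \<in> borel_measurable M \<Longrightarrow> (\<And>x. cmod (h x) \<le> 1) \<Longrightarrow>
                 bounded ((\<lambda>f. \<integral>x. h x * f x \<partial>M) ` S)"
  shows "\<exists>C. \<forall>f\<in>S. (\<integral>x. cmod (f x) \<partial>M) \<le> C"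
proof (rule ccontr)
  assume "\<not> ?thesis"
  \<comment> \<open>The factor 4^(k+1) is matched to increments of size 3^-(k+1): the quotient
    (4/3)^(k+1) still tends to infinity.\<close>
  then have "\<forall>k::nat. \<exists>f\<in>S. (\<integral>x. cmod (f x) \<partial>M) > 4 ^ Suc k"
    by (meson not_le)
  then obtain f where f: "\<And>k. f k \<in> S" and big: "\<And>k::nat. (\<integral>x. cmod (f k x) \<partial>M) > 4 ^ Suc k"
    by metis
  define I where "I k = (\<integral>x. cmod (f k x) \<partial>M)" for k
  have intf: "integrable M (f k)" for k
    using int f by auto
  have fM [measurable]: "f k \<in> borel_measurable M" for k
    using intf by auto
  \<comment> \<open>The conjugate phase of \<open>f k\<close>, scaled, so that
    \<open>u k x * f k x\<close> is a nonnegative real. Where \<open>f k\<close> vanishes, division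
    by zero gives the value 0.\<close>
  define u where "u k x = (1/3) ^ Suc k * (cnj (f k x) / of_real (cmod (f k x)))" for k x
  have [measurable]: "u k \<in> borel_measurable M" for k
  proof -
    have "(\<lambda>x. cnj (f k x)) \<in> borel_measurable M"
      by (rule measurable_compose[OF fM]) (intro borel_measurable_continuous_onI continuous_intros)
    moreover have "(\<lambda>x. complex_of_real (cmod (f k x))) \<in> borel_measurable M"
      by (rule measurable_compose[OF fM]) (intro borel_measurable_continuous_onI continuous_intros)
    ultimately show ?thesis
      unfolding u_def by (intro borel_measurable_times borel_measurable_divide borel_measurable_const)
  qed
  have norm_u: "cmod (u k x) \<le> (1/3) ^ Suc k" for k x
    by (cases "f k x = 0") (simp_all add: u_def norm_mult norm_divide norm_power)
  have u_f: "u k x * f k x = of_real ((1/3) ^ Suc k * cmod (f k x))" for k x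
  proof (cases "f k x = 0")
    case False
    have "cnj (f k x) * f k x = of_real (cmod (f k x)) * of_real (cmod (f k x))"
      using complex_norm_square[of "f k x"] by (simp add: power2_eq_square mult.commute)
    then have eq: "cnj (f k x) / of_real (cmod (f k x)) * f k x = of_real (cmod (f k x))"
      using False by simp
    have "u k x * f k x = (1/3) ^ Suc k * (cnj (f k x) / of_real (cmod (f k x)) * f k x)"
      by (simp only: u_def mult.assoc)
    then show ?thesis
      unfolding eq by simp
  qed (simp add: u_def)
  txt \<open>Gliding hump: the sign of the \<open>k\<close>-th increment \<open>\<plusminus>u k\<close> is chosen so that \<open>T k (X (Suc k))\<close> is at
    least \<open>3\<^sup>-\<^sup>k\<^sup>-\<^sup>1 I k\<close>; the remaining increments can destroy at most half of that.\<close>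
  define T where "T k h = (\<integral>x. h x * f k x \<partial>M)" for k h
  define X where "X = rec_nat (\<lambda>x. 0)
     (\<lambda>k g. if (1/3) ^ Suc k * I k \<le> cmod (T k (\<lambda>x. g x + u k x)) then (\<lambda>x. g x + u k x) else (\<lambda>x. g x - u k x))"
  have X0: "X 0 = (\<lambda>x. 0)" by (simp add: X_def)
  have XS: "X (Suc k) = (if (1/3) ^ Suc k * I k \<le> cmod (T k (\<lambda>x. X k x + u k x))
      then (\<lambda>x. X k x + u k x) else (\<lambda>x. X k x - u k x))" for k
    by (simp add: X_def)
  have diff: "cmod (X (Suc k) x - X k x) \<le> (1/3) ^ Suc k" for k x
    using norm_u[of k x] by (simp add: XS)
  have [measurable]: "X k \<in> borel_measurable M" for k
    by (induction k) (simp_all add: X0 XS)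
  have geo: "summable (\<lambda>k. (1/3::real) ^ Suc k)"
    by (subst summable_Suc_iff) (rule summable_geometric, simp)
  define h where "h x = (\<Sum>k. X (Suc k) x - X k x)" for x
  have summ: "summable (\<lambda>k. X (Suc k) x - X k x)" for x
    by (rule summable_comparison_test'[OF geo diff])
  have [measurable]: "h \<in> borel_measurable M"
    unfolding h_def by measurable
  \<comment> \<open>All increments from stage \<open>k\<close> on add up to at most 3^-k / 2. Used
    at \<open>Suc k\<close>, this is half of the bound 3^-(k+1) on \<open>u k\<close>.\<close>
  have tail: "cmod (h x - X k x) \<le> (1/2) * (1/3) ^ k" for k x
  proof -
    have "(\<lambda>j. (1/3::real) ^ Suc (j + k)) sums ((1/3) ^ Suc k * (1 / (1 - 1/3)))"
      using sums_mult[OF geometric_sums[of "1/3::real"], of "(1/3) ^ Suc k"]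
      by (simp add: power_add ac_simps)
    then have geo_tail: "(\<Sum>j. (1/3::real) ^ Suc (j + k)) = (1/2) * (1/3) ^ k"
      by (simp add: sums_iff)
    have "h x - X k x = (\<Sum>j. X (Suc (j + k)) x - X (j + k) x)"
      using suminf_split_initial_segment[OF summ, of x k]
      unfolding h_def by (simp add: sum_lessThan_telescope[of "\<lambda>k. X k x"] X0)
    also have "cmod \<dots> \<le> (\<Sum>j. (1/3) ^ Suc (j + k))"
      using geo by (intro norm_suminf_le diff summable_ignore_initial_segment)
    also note geo_tail
    finally show ?thesis .
  qed
  have norm_h: "cmod (h x) \<le> 1" for x
    using tail[of x 0] by (simp add: X0)
  have norm_X: "cmod (X k x) \<le> 2" for k x
  proof -
    have "cmod (X k x) \<le> cmod (h x) + cmod (h x - X k x)"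
      by (metis add.commute diff_add_cancel norm_minus_commute norm_triangle_sub)
    also have "\<dots> \<le> 1 + 1 * 1"
      using power_le_one[of "1/3::real" k]
      by (intro add_mono norm_h order_trans[OF tail] mult_mono) auto
    finally show ?thesis by simp
  qed
  have integ: "integrable M (\<lambda>x. g x * f k x)"
    if [measurable]: "g \<in> borel_measurable M" and "\<And>x. cmod (g x) \<le> B" for g B k
  proof (rule Bochner_Integration.integrable_bound)
    show "integrable M (\<lambda>x. B * cmod (f k x))"
      using intf by auto
    have "cmod (g x) * cmod (f k x) \<le> \<bar>B\<bar> * cmod (f k x)" for x
      using that(2)[of x] by (intro mult_right_mono) auto
    then show "AE x in M. norm (g x * f k x) \<le> norm (B * cmod (f k x))"
      by (simp add: norm_mult abs_mult)
  qed measurable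
  have iX: "integrable M (\<lambda>x. X j x * f k x)" for j k
    using norm_X by (intro integ) auto
  have iu: "integrable M (\<lambda>x. u j x * f k x)" for j k
    by (rule integ[OF _ norm_u]) measurable
  have ih: "integrable M (\<lambda>x. h x * f k x)" for k
    using norm_h by (intro integ) auto
  have Tu: "T k (u k) = of_real ((1/3) ^ Suc k * I k)" for k
    unfolding T_def u_f I_def by (simp del: of_real_mult)
  have large: "(1/3) ^ Suc k * I k \<le> cmod (T k (X (Suc k)))" for k
  proof -
    \<comment> \<open>The values of \<open>T k\<close> at the two candidates differ by
      \<open>2 * T k (u k)\<close>, so one of them has modulus at least that of
      \<open>T k (u k)\<close>; if the plus sign fails, the minus sign works.\<close>
    have "T k (\<lambda>x. X k x + u k x) - T k (\<lambda>x. X k x - u k x) = 2 * T k (u k)"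
      (is "?d = _")
      using iX iu unfolding T_def by (simp add: ring_distribs)
    then have "2 * ((1/3) ^ Suc k * I k) = cmod ?d"
      unfolding Tu by (simp only: norm_mult norm_of_real norm_numeral) (simp add: I_def del: power_Suc)
    also have "\<dots> \<le> cmod (T k (\<lambda>x. X k x + u k x)) + cmod (T k (\<lambda>x. X k x - u k x))"
      by (rule norm_triangle_ineq4)
    finally show ?thesis by (auto simp: XS)
  qed
  have Th: "(1/2) * (4/3) ^ Suc k \<le> cmod (T k h)" for k
  proof -
    have "cmod (T k h - T k (X (Suc k))) = cmod (\<integral>x. (h x - X (Suc k) x) * f k x \<partial>M)"
      using ih iX unfolding T_def by (simp add: ring_distribs)
    also have "\<dots> \<le> (\<integral>x. (1/2) * (1/3) ^ Suc k * cmod (f k x) \<partial>M)"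
    proof (rule order_trans[OF integral_norm_bound], rule integral_mono_AE)
      show "AE x in M. norm ((h x - X (Suc k) x) * f k x) \<le> (1/2) * (1/3) ^ Suc k * cmod (f k x)"
        unfolding norm_mult by (intro AE_I2 mult_right_mono tail norm_ge_zero)
      show "integrable M (\<lambda>x. norm ((h x - X (Suc k) x) * f k x))"
        using ih iX by (simp add: ring_distribs)
    qed (use intf in auto)
    also have "\<dots> = (1/2) * ((1/3) ^ Suc k * I k)"
      by (simp add: I_def)
    finally have "(1/2) * ((1/3) ^ Suc k * I k) \<le> cmod (T k h)"
      using large[of k] norm_triangle_ineq2[of "T k (X (Suc k))" "T k h"]
      by (simp add: norm_minus_commute del: power_Suc)
    moreover have "(1/3) ^ Suc k * 4 ^ Suc k \<le> (1/3) ^ Suc k * I k"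
      using big[of k] by (intro mult_left_mono) (auto simp: I_def)
    ultimately show ?thesis
      by (simp add: power_mult_distrib[symmetric] del: power_Suc)
  qed
  have "bounded ((\<lambda>f. \<integral>x. h x * f x \<partial>M) ` S)"
    using norm_h by (intro weak) auto
  then obtain B where B: "\<And>k. cmod (T k h) \<le> B"
    unfolding bounded_iff T_def using f by auto
  obtain k where "2 * B < (4/3) ^ k"
    using real_arch_pow[of "4/3" "2 * B"] by auto
  also have "(4/3::real) ^ k \<le> (4/3) ^ Suc k"
    by (intro power_increasing) auto
  finally show False using Th[of k] B[of k] by simp
qed

section \<open>Lerch's theorem for transforms at the natural numbers\<close>

text \<open>The positive and negative parts of \<open>g\<close> are densities of finite measures
  that agree on open half-lines, hence everywhere. So the two parts agree almost everywhere, and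
  then both vanish.\<close>

lemma AE_zero_if_integral_greaterThan_zero:
  fixes g :: "real \<Rightarrow> real"
  assumes g: "integrable lborel g"
    and zero: "\<And>c. (\<integral>t. indicator {c<..} t * g t \<partial>lborel) = 0"
  shows "AE t in lborel. g t = 0"
proof -
  have [measurable]: "g \<in> borel_measurable borel"
    using g by auto
  let ?p = "\<lambda>t. max 0 (g t)" and ?q = "\<lambda>t. max 0 (- g t)"
  have p: "integrable lborel ?p" and q: "integrable lborel ?q"
    using g by auto
  have pc: "integrable lborel (\<lambda>t. indicator {c<..} t * ?p t)" for c
    using integrable_mult_indicator[OF _ p, of "{c<..}"] by simp
  have qc: "integrable lborel (\<lambda>t. indicator {c<..} t * ?q t)" for c
    using integrable_mult_indicator[OF _ q, of "{c<..}"] by simp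
  have P: "emeasure (density lborel (\<lambda>t. ennreal (?p t))) {c<..} = ennreal (\<integral>t. indicator {c<..} t * ?p t \<partial>lborel)" for c
    unfolding nn_integral_eq_integral[OF pc, symmetric, simplified]
    by (auto simp: emeasure_density ennreal_mult' ennreal_indicator mult.commute intro!: nn_integral_cong)
  have Q: "emeasure (density lborel (\<lambda>t. ennreal (?q t))) {c<..} = ennreal (\<integral>t. indicator {c<..} t * ?q t \<partial>lborel)" for c
    unfolding nn_integral_eq_integral[OF qc, symmetric, simplified]
    by (auto simp: emeasure_density ennreal_mult' ennreal_indicator mult.commute intro!: nn_integral_cong)
  have "density lborel (\<lambda>t. ennreal (?p t)) = density lborel (\<lambda>t. ennreal (?q t))"
  proof (rule measure_eqI_lessThan)
    fix c
    have "(\<integral>t. indicator {c<..} t * ?p t \<partial>lborel) - (\<integral>t. indicator {c<..} t * ?q t \<partial>lborel)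
       = (\<integral>t. indicator {c<..} t * g t \<partial>lborel)"
      by (subst Bochner_Integration.integral_diff[OF pc qc, symmetric])
         (auto intro!: Bochner_Integration.integral_cong simp: max_def algebra_simps)
    then show "emeasure (density lborel (\<lambda>t. ennreal (?p t))) {c<..} = emeasure (density lborel (\<lambda>t. ennreal (?q t))) {c<..}"
      unfolding P Q using zero[of c] by simp
  qed (simp_all add: P)
  then have "AE t in lborel. ennreal (?p t) = ennreal (?q t)"
    by (intro sigma_finite_measure.density_unique[OF lborel.sigma_finite_measure_axioms]) auto
  then show ?thesis
    by eventually_elim (auto simp: max_def split: if_splits)
qed

text \<open>The substitution x = exp(-t) turns the transforms into moments on [0,1]. Weierstrass
  approximation passes from polynomials to continuous functions of exp(-t), and dominated
  convergence to indicators of half-lines.\<close>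

lemma Lerch_real:
  fixes g :: "real \<Rightarrow> real"
  assumes g: "integrable lborel g" and neg: "\<And>t. t < 0 \<Longrightarrow> g t = 0"
    and zero: "\<And>k::nat. (\<integral>t. exp (- (real k * t)) * g t \<partial>lborel) = 0"
  shows "AE t in lborel. g t = 0"
proof (rule AE_zero_if_integral_greaterThan_zero[OF g])
  fix c :: real
  have [measurable]: "g \<in> borel_measurable borel"
    using g by auto
  \<comment> \<open>The multiplier has to be bounded only for \<open>0 \<le> t\<close>, because
    \<open>g\<close> vanishes elsewhere; this matters since exp(-t) leaves [0,1] for negative
    t.\<close>
  have int: "integrable lborel (\<lambda>t. h t * g t)"
    if [measurable]: "h \<in> borel_measurable borel" and b: "\<And>t. 0 \<le> t \<Longrightarrow> \<bar>h t\<bar> \<le> B" for h B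
  proof (rule Bochner_Integration.integrable_bound)
    show "integrable lborel (\<lambda>t. B * g t)" using g by simp
    have "\<bar>h t * g t\<bar> \<le> \<bar>B * g t\<bar>" for t
      using b[of t] neg[of t] by (cases "t < 0") (auto simp: abs_mult intro!: mult_right_mono)
    then show "AE t in lborel. norm (h t * g t) \<le> norm (B * g t)" by simp
  qed measurable
  have poly: "(\<integral>t. p (exp (- t)) * g t \<partial>lborel) = 0" if rp: "real_polynomial_function p" for p
  proof -
    obtain a n where p: "p = (\<lambda>x. \<Sum>i\<le>n. a i * x ^ i)"
      using rp by (auto simp: real_polynomial_function_iff_sum)
    have i: "integrable lborel (\<lambda>t. exp (- (real k * t)) * g t)" for k
      by (rule int[of _ 1]) auto
    have "(\<integral>t. p (exp (- t)) * g t \<partial>lborel) = (\<integral>t. (\<Sum>k\<le>n. a k * (exp (- (real k * t)) * g t)) \<partial>lborel)"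
      by (simp add: p sum_distrib_right mult.assoc exp_of_nat_mult[symmetric])
    also have "\<dots> = 0"
      using i by (simp add: zero)
    finally show ?thesis .
  qed
  have cont: "(\<integral>t. h (exp (- t)) * g t \<partial>lborel) = 0" if h: "continuous_on UNIV h" for h :: "real \<Rightarrow> real"
  proof -
    have [measurable]: "h \<in> borel_measurable borel"
      using h by (rule borel_measurable_continuous_onI)
    have "bounded (h ` {0..1})"
      by (intro compact_imp_bounded compact_continuous_image continuous_on_subset[OF h]) auto
    then obtain B where "\<forall>x\<in>{0..1}. \<bar>h x\<bar> \<le> B"
      by (auto simp: bounded_iff)
    then have ih: "integrable lborel (\<lambda>t. h (exp (- t)) * g t)"
      by (intro int[of _ B]) auto
    have "\<bar>\<integral>t. h (exp (- t)) * g t \<partial>lborel\<bar> \<le> e * (\<integral>t. \<bar>g t\<bar> \<partial>lborel)" if e: "0 < e" for e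
    proof -
      obtain p where p: "real_polynomial_function p" and ph: "\<And>x. x \<in> {0..1} \<Longrightarrow> \<bar>h x - p x\<bar> < e"
        using Stone_Weierstrass_real_polynomial_function[of "{0..1}" h e] e continuous_on_subset[OF h] by auto
      have [measurable]: "p \<in> borel_measurable borel"
        using p by (intro borel_measurable_continuous_onI continuous_on_polymonial_function)
          (simp add: real_polynomial_function_eq)
      have idiff: "integrable lborel (\<lambda>t. (h (exp (- t)) - p (exp (- t))) * g t)"
        by (intro int[of _ e] less_imp_le ph) auto
      have ip: "integrable lborel (\<lambda>t. p (exp (- t)) * g t)"
        using Bochner_Integration.integrable_diff[OF ih idiff] by (simp add: algebra_simps)
      have "\<bar>\<integral>t. h (exp (- t)) * g t \<partial>lborel\<bar> = \<bar>\<integral>t. (h (exp (- t)) - p (exp (- t))) * g t \<partial>lborel\<bar>"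
        using ih ip poly[OF p] by (simp add: left_diff_distrib)
      also have "\<dots> \<le> (\<integral>t. e * \<bar>g t\<bar> \<partial>lborel)"
      proof -
        have "\<bar>(h (exp (- t)) - p (exp (- t))) * g t\<bar> \<le> e * \<bar>g t\<bar>" for t
          using ph[of "exp (- t)"] neg[of t] by (cases "t < 0") (auto simp: abs_mult intro!: mult_right_mono)
        then have "(\<integral>t. \<bar>(h (exp (- t)) - p (exp (- t))) * g t\<bar> \<partial>lborel) \<le> (\<integral>t. e * \<bar>g t\<bar> \<partial>lborel)"
          using idiff g by (intro integral_mono) auto
        then show ?thesis
          by (rule order_trans[OF integral_abs_bound])
      qed
      finally show ?thesis by simp
    qed
    moreover have "((\<lambda>e. e * (\<integral>t. \<bar>g t\<bar> \<partial>lborel)) \<longlongrightarrow> 0 * (\<integral>t. \<bar>g t\<bar> \<partial>lborel)) (at_right 0)"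
      by (intro tendsto_intros)
    ultimately have "\<bar>\<integral>t. h (exp (- t)) * g t \<partial>lborel\<bar> \<le> 0 * (\<integral>t. \<bar>g t\<bar> \<partial>lborel)"
      by (intro tendsto_lowerbound[of _ _ "at_right 0"]) (auto intro!: eventually_at_rightI[of 0 1])
    then show ?thesis by simp
  qed
  \<comment> \<open>For n > 0 a continuous ramp, equal to 0 for x \<ge> exp(-c) and to 1 for x \<le>
    exp(-c) - 1/n. As exp(-t) < exp(-c) exactly when c < t, the functions
    \<open>h n (exp (- t))\<close> tend to the indicator of \<open>{c<..}\<close>.\<close>
  define h where "h n x = min 1 (max 0 (real n * (exp (- c) - x)))" for n x
  have "(\<lambda>n. \<integral>t. h n (exp (- t)) * g t \<partial>lborel) \<longlonglongrightarrow> (\<integral>t. indicator {c<..} t * g t \<partial>lborel)"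
  proof (rule integral_dominated_convergence)
    show "integrable lborel (\<lambda>t. \<bar>g t\<bar>)" using g by simp
    show "AE t in lborel. norm (h n (exp (- t)) * g t) \<le> \<bar>g t\<bar>" for n
      by (auto simp: h_def abs_mult intro!: mult_left_le_one_le)
    have "(\<lambda>n. h n (exp (- t))) \<longlonglongrightarrow> indicator {c<..} t" for t
    proof (cases "c < t")
      case True
      obtain m where m: "1 / (exp (- c) - exp (- t)) < real m"
        using reals_Archimedean2 by blast
      have "h n (exp (- t)) = 1" if "n \<ge> m" for n
      proof -
        have "1 / (exp (- c) - exp (- t)) < real n" using m that by linarith
        then have "1 < real n * (exp (- c) - exp (- t))" using True by (simp add: field_simps)
        then show ?thesis by (simp add: h_def)
      qed
      then show ?thesis using True
        by (intro tendsto_eventually eventually_sequentiallyI[of m]) auto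
    next
      case False
      then have "real n * (exp (- c) - exp (- t)) \<le> 0" for n
        by (intro mult_nonneg_nonpos) auto
      then have "h n (exp (- t)) = 0" for n
        unfolding h_def by (metis max.absorb1 min.absorb2 zero_le_one)
      with False show ?thesis by simp
    qed
    then show "AE t in lborel. (\<lambda>n. h n (exp (- t)) * g t) \<longlonglongrightarrow> indicator {c<..} t * g t"
      by (auto intro!: tendsto_intros)
  qed (auto simp: h_def)
  moreover have "(\<integral>t. h n (exp (- t)) * g t \<partial>lborel) = 0" for n
    unfolding h_def by (intro cont continuous_intros)
  ultimately show "(\<integral>t. indicator {c<..} t * g t \<partial>lborel) = 0"
    by (simp add: LIMSEQ_const_iff)
qed

lemma Lerch:
  fixes g :: "real \<Rightarrow> complex"
  assumes g: "integrable lborel g" and neg: "\<And>t. t < 0 \<Longrightarrow> g t = 0"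
    and zero: "\<And>k::nat. (\<integral>t. of_real (exp (- (real k * t))) * g t \<partial>lborel) = 0"
  shows "AE t in lborel. g t = 0"
proof -
  have [measurable]: "g \<in> borel_measurable borel"
    using g by auto
  have int: "integrable lborel (\<lambda>t. of_real (exp (- (real k * t))) * g t)" for k
  proof (rule Bochner_Integration.integrable_bound[OF g])
    have "cmod (of_real (exp (- (real k * t))) * g t) \<le> cmod (g t)" for t
      using neg[of t] by (cases "t < 0") (auto simp: norm_mult intro!: mult_left_le_one_le)
    then show "AE t in lborel. norm (of_real (exp (- (real k * t))) * g t) \<le> norm (g t)" by simp
  qed measurable
  have "AE t in lborel. Re (g t) = 0"
    using integral_Re[OF int] g neg zero by (intro Lerch_real) auto
  moreover have "AE t in lborel. Im (g t) = 0"
    using integral_Im[OF int] g neg zero by (intro Lerch_real) auto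
  ultimately show ?thesis
    by eventually_elim (simp add: complex_eq_iff)
qed

section \<open>Integrals of convolutions over the whole line\<close>

text \<open>Tonelli and translation invariance. This yields both the absolute integrability behind
  Fubini in \<open>integral_convolution\<close> and the submultiplicativity of the weighted
  norms.\<close>

lemma nn_integral_convolution:
  fixes f g :: "real \<Rightarrow> ennreal"
  assumes [measurable]: "f \<in> borel_measurable borel" "g \<in> borel_measurable borel"
  shows "(\<integral>\<^sup>+t. \<integral>\<^sup>+s. f s * g (t - s) \<partial>lborel \<partial>lborel) = (\<integral>\<^sup>+s. f s \<partial>lborel) * (\<integral>\<^sup>+t. g t \<partial>lborel)"
proof -
  have shift: "(\<integral>\<^sup>+t. g (t - s) \<partial>lborel) = (\<integral>\<^sup>+t. g t \<partial>lborel)" for s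
    using nn_integral_real_affine[of g 1 "- s"] by simp
  have "(\<integral>\<^sup>+t. \<integral>\<^sup>+s. f s * g (t - s) \<partial>lborel \<partial>lborel) = (\<integral>\<^sup>+s. \<integral>\<^sup>+t. f s * g (t - s) \<partial>lborel \<partial>lborel)"
    by (rule lborel_pair.Fubini') measurable
  also have "\<dots> = (\<integral>\<^sup>+s. f s \<partial>lborel) * (\<integral>\<^sup>+t. g t \<partial>lborel)"
    by (simp add: nn_integral_cmult shift nn_integral_multc)
  finally show ?thesis .
qed

lemma integral_convolution:
  fixes f g :: "real \<Rightarrow> complex"
  assumes f: "integrable lborel f" and g: "integrable lborel g"
  shows "(\<integral>t. \<integral>s. f s * g (t - s) \<partial>lborel \<partial>lborel) = (\<integral>s. f s \<partial>lborel) * (\<integral>t. g t \<partial>lborel)"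
proof -
  have [measurable]: "f \<in> borel_measurable borel" "g \<in> borel_measurable borel"
    using f g by auto
  have shift: "(\<integral>t. g (t - s) \<partial>lborel) = (\<integral>t. g t \<partial>lborel)" for s
    using lborel_integral_real_affine[of 1 g "- s"] by simp
  have "integrable (lborel \<Otimes>\<^sub>M lborel) (\<lambda>(t, s). f s * g (t - s))"
  proof (rule integrableI_bounded)
    have "(\<integral>\<^sup>+z. norm (case z of (t, s) \<Rightarrow> f s * g (t - s)) \<partial>(lborel \<Otimes>\<^sub>M lborel)) =
       (\<integral>\<^sup>+t. \<integral>\<^sup>+s. ennreal (cmod (f s)) * ennreal (cmod (g (t - s))) \<partial>lborel \<partial>lborel)"
      by (subst lborel.nn_integral_fst[symmetric]) (simp_all add: norm_mult ennreal_mult)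
    also have "\<dots> = (\<integral>\<^sup>+s. ennreal (cmod (f s)) \<partial>lborel) * (\<integral>\<^sup>+t. ennreal (cmod (g t)) \<partial>lborel)"
      by (rule nn_integral_convolution) measurable
    also have "\<dots> < \<infinity>"
      using f g by (simp add: integrable_iff_bounded ennreal_mult_less_top)
    finally show "(\<integral>\<^sup>+z. norm (case z of (t, s) \<Rightarrow> f s * g (t - s)) \<partial>(lborel \<Otimes>\<^sub>M lborel)) < \<infinity>" .
  qed measurable
  then have "(\<integral>t. \<integral>s. f s * g (t - s) \<partial>lborel \<partial>lborel) = (\<integral>s. \<integral>t. f s * g (t - s) \<partial>lborel \<partial>lborel)"
    by (intro lborel_pair.Fubini_integral[symmetric]) (simp add: case_prod_beta')
  also have "\<dots> = (\<integral>s. f s \<partial>lborel) * (\<integral>t. g t \<partial>lborel)"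
    by (simp add: shift)
  finally show ?thesis .
qed

section \<open>The algebras of weighted integrable functions\<close>

text \<open>A chosen representative, extended by 0, which makes convolution over [0,t] a convolution
  over the whole line. The choice of representatives is not linear, so the algebraic rules below
  hold only almost everywhere.\<close>

definition ext0 :: "halfline_fun \<Rightarrow> real \<Rightarrow> complex" where
  "ext0 F t = indicator {0..} t *\<^sub>R rep_halfline_fun F t"

lemma ae_eq_rep: "ae_eq (rep_halfline_fun F) (rep_halfline_fun F)"
  using Quotient_rep_reflp[OF Quotient_halfline_fun] .

lemma abs_rep: "abs_halfline_fun (rep_halfline_fun F) = F"
  using Quotient_abs_rep[OF Quotient_halfline_fun] .

lemma ae_eq_rep_abs: "ae_eq f f \<Longrightarrow> ae_eq (rep_halfline_fun (abs_halfline_fun f)) f"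
  using Quotient_rep_abs[OF Quotient_halfline_fun] .

lemma ext0_measurable [measurable]: "ext0 F \<in> borel_measurable borel"
  using ae_eq_rep[of F] unfolding ext0_def ae_eq_def
  by (simp add: borel_measurable_restrict_space_iff)

lemma ext0_neg: "t < 0 \<Longrightarrow> ext0 F t = 0"
  by (simp add: ext0_def)

lemma AE_ext0_abs:
  assumes "ae_eq f f"
  shows "AE t in lborel. ext0 (abs_halfline_fun f) t = indicator {0..} t *\<^sub>R f t"
  using ae_eq_rep_abs[OF assms]
  by (auto simp: ae_eq_def AE_restrict_space_iff ext0_def indicator_def elim: eventually_mono)

lemma AE_ext0_add: "AE t in lborel. ext0 (F + G) t = ext0 F t + ext0 G t"
proof -
  have "ae_eq (\<lambda>t. rep_halfline_fun F t + rep_halfline_fun G t) (\<lambda>t. rep_halfline_fun F t + rep_halfline_fun G t)"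
    using ae_eq_rep[of F] ae_eq_rep[of G] by (auto simp: ae_eq_def)
  from AE_ext0_abs[OF this] show ?thesis
    using plus_halfline_fun.abs_eq[OF ae_eq_rep[of F] ae_eq_rep[of G]]
    by (simp add: abs_rep ext0_def scaleR_add_right)
qed

lemma AE_ext0_uminus: "AE t in lborel. ext0 (- F) t = - ext0 F t"
proof -
  have "ae_eq (\<lambda>t. - rep_halfline_fun F t) (\<lambda>t. - rep_halfline_fun F t)"
    using ae_eq_rep[of F] by (auto simp: ae_eq_def)
  from AE_ext0_abs[OF this] show ?thesis
    using uminus_halfline_fun.abs_eq[OF ae_eq_rep[of F]]
    by (simp add: abs_rep ext0_def)
qed

lemma AE_ext0_cscale: "AE t in lborel. ext0 (cscale c F) t = c * ext0 F t"
proof -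
  have "ae_eq (\<lambda>t. c * rep_halfline_fun F t) (\<lambda>t. c * rep_halfline_fun F t)"
    using ae_eq_rep[of F] by (auto simp: ae_eq_def)
  from AE_ext0_abs[OF this] show ?thesis
    using cscale.abs_eq[OF ae_eq_rep[of F], of c]
    by (simp add: abs_rep ext0_def)
qed

lemma AE_ext0_zero: "AE t in lborel. ext0 0 t = 0"
  using AE_ext0_abs[of "\<lambda>_. 0"] by (simp add: zero_halfline_fun_def[symmetric] ae_eq_def)

lemma AE_ext0_convolution:
  "AE t in lborel. ext0 (F \<star> G) t = (\<integral>s. ext0 F s * ext0 G (t - s) \<partial>lborel)"
proof -
  let ?c = "\<lambda>t. LINT s:{0..t}|lborel. rep_halfline_fun F s * rep_halfline_fun G (t - s)"
  have "ae_eq ?c ?c"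
    using ae_eq_rep[of F] ae_eq_rep[of G] by (auto simp: ae_eq_def borel_measurable_convolution)
  note AE_ext0_abs[OF this]
  moreover have "abs_halfline_fun ?c = F \<star> G"
    using convolution.abs_eq[OF ae_eq_rep[of F] ae_eq_rep[of G]] by (simp add: abs_rep)
  moreover have "indicator {0..} t *\<^sub>R ?c t = (\<integral>s. ext0 F s * ext0 G (t - s) \<partial>lborel)" for t
  proof (cases "0 \<le> t")
    case True
    then show ?thesis
      by (simp add: set_integral_convolution_eq ext0_def)
  next
    case False
    then have "ext0 F s * ext0 G (t - s) = 0" for s
      by (cases "s < 0") (simp_all add: ext0_neg)
    then have "(\<integral>s. ext0 F s * ext0 G (t - s) \<partial>lborel) = 0"
      by (simp only: integral_zero)
    with False show ?thesis by simp
  qed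
  ultimately show ?thesis by simp
qed

lemma eq_0_if_AE_ext0_eq_0:
  assumes "AE t in lborel. ext0 F t = 0"
  shows "F = 0"
proof -
  have "ae_eq (rep_halfline_fun F) (\<lambda>_. 0)"
    using ae_eq_rep[of F] assms
    by (auto simp: ae_eq_def AE_restrict_space_iff ext0_def elim: eventually_mono)
  then have "abs_halfline_fun (rep_halfline_fun F) = abs_halfline_fun (\<lambda>_. 0)"
    using Quotient_rel_abs[OF Quotient_halfline_fun] by blast
  then show ?thesis
    by (simp add: abs_rep zero_halfline_fun_def)
qed

section \<open>Weighted norms and their submultiplicativity\<close>

text \<open>The values of a weight at negative arguments are arbitrary; cutting them off gives a
  nonnegative Borel function on the line.\<close>

definition weight0 :: "(real \<Rightarrow> real) \<Rightarrow> real \<Rightarrow> real" where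
  "weight0 w t = indicator {0..} t * w t"

lemma weight0_measurable: "algebra_weight w \<Longrightarrow> weight0 w \<in> borel_measurable borel"
  by (simp add: algebra_weight_def weight0_def[abs_def] borel_measurable_restrict_space_iff)

lemma weight0_nonneg: "algebra_weight w \<Longrightarrow> 0 \<le> weight0 w t"
  by (auto simp: algebra_weight_def weight0_def indicator_def less_imp_le)

lemma wnorm_ext0: "wnorm w F = (\<integral>\<^sup>+t. ennreal (cmod (ext0 F t)) * ennreal (weight0 w t) \<partial>lborel)"
proof -
  have "wnorm w F = (\<integral>\<^sup>+t. ennreal (cmod (rep_halfline_fun F t) * w t) \<partial>lborel_plus)"
    using wnorm.abs_eq[OF ae_eq_rep[of F], of w] by (simp add: abs_rep)
  also have "\<dots> = (\<integral>\<^sup>+t. ennreal (cmod (rep_halfline_fun F t) * w t) * indicator {0..} t \<partial>lborel)"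
    by (subst nn_integral_restrict_space) simp_all
  also have "\<dots> = (\<integral>\<^sup>+t. ennreal (cmod (ext0 F t)) * ennreal (weight0 w t) \<partial>lborel)"
    by (intro nn_integral_cong) (auto simp: ext0_def weight0_def indicator_def ennreal_mult')
  finally show ?thesis .
qed

lemma wnorm_zero: "wnorm w 0 = 0"
proof -
  have "wnorm w 0 = (\<integral>\<^sup>+t. 0 \<partial>(lborel :: real measure))"
    unfolding wnorm_ext0 using AE_ext0_zero by (intro nn_integral_cong_AE) (auto elim: eventually_mono)
  then show ?thesis by simp
qed

lemma wnorm_add:
  assumes "algebra_weight w"
  shows "wnorm w (F + G) \<le> wnorm w F + wnorm w G"
proof -
  note [measurable] = weight0_measurable[OF assms]
  have "wnorm w (F + G) \<le> (\<integral>\<^sup>+t. ennreal (cmod (ext0 F t)) * ennreal (weight0 w t) +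
      ennreal (cmod (ext0 G t)) * ennreal (weight0 w t) \<partial>lborel)"
    unfolding wnorm_ext0
  proof (rule nn_integral_mono_AE)
    show "AE t in lborel. ennreal (cmod (ext0 (F + G) t)) * ennreal (weight0 w t) \<le>
        ennreal (cmod (ext0 F t)) * ennreal (weight0 w t) + ennreal (cmod (ext0 G t)) * ennreal (weight0 w t)"
      using AE_ext0_add[of F G]
    proof eventually_elim
      case (elim t)
      show ?case
        unfolding elim distrib_right[symmetric]
        by (intro mult_right_mono)
           (simp_all add: ennreal_plus[symmetric] norm_triangle_ineq del: ennreal_plus)
    qed
  qed
  also have "\<dots> = wnorm w F + wnorm w G"
    unfolding wnorm_ext0 by (rule nn_integral_add) measurable
  finally show ?thesis .
qed

lemma wnorm_uminus: "wnorm w (- F) = wnorm w F"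
  unfolding wnorm_ext0 using AE_ext0_uminus[of F] by (intro nn_integral_cong_AE) (auto elim: eventually_mono)

lemma wnorm_cscale:
  assumes "algebra_weight w"
  shows "wnorm w (cscale c F) = ennreal (cmod c) * wnorm w F"
proof -
  note [measurable] = weight0_measurable[OF assms]
  have "wnorm w (cscale c F) = (\<integral>\<^sup>+t. ennreal (cmod c) * (ennreal (cmod (ext0 F t)) * ennreal (weight0 w t)) \<partial>lborel)"
    unfolding wnorm_ext0 using AE_ext0_cscale[of c F]
    by (intro nn_integral_cong_AE) (auto simp: norm_mult ennreal_mult mult.assoc elim: eventually_mono)
  also have "\<dots> = ennreal (cmod c) * wnorm w F"
    unfolding wnorm_ext0 by (rule nn_integral_cmult) measurable
  finally show ?thesis .
qed

text \<open>Inside the convolution integral w(t) \<le> w(s) w(t - s), so the weighted integrand is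
  dominated by a convolution of nonnegative functions and Tonelli applies.\<close>

lemma wnorm_convolution:
  assumes w: "algebra_weight w"
  shows "wnorm w (F \<star> G) \<le> wnorm w F * wnorm w G"
proof -
  note [measurable] = weight0_measurable[OF assms]
  let ?f = "\<lambda>s. ennreal (cmod (ext0 F s)) * ennreal (weight0 w s)"
  let ?g = "\<lambda>s. ennreal (cmod (ext0 G s)) * ennreal (weight0 w s)"
  have "wnorm w (F \<star> G) \<le> (\<integral>\<^sup>+t. \<integral>\<^sup>+s. ?f s * ?g (t - s) \<partial>lborel \<partial>lborel)"
    unfolding wnorm_ext0[of w "F \<star> G"]
  proof (rule nn_integral_mono_AE)
    have le: "ennreal (cmod (\<integral>s. ext0 F s * ext0 G (t - s) \<partial>lborel)) * ennreal (weight0 w t) \<le>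
       (\<integral>\<^sup>+s. ?f s * ?g (t - s) \<partial>lborel)" for t
    proof -
      \<comment> \<open>For a non-integrable integrand the Bochner integral is 0 by default and the
        estimate is trivial.\<close>
      have "ennreal (cmod (\<integral>s. ext0 F s * ext0 G (t - s) \<partial>lborel)) \<le>
         (\<integral>\<^sup>+s. ennreal (cmod (ext0 F s * ext0 G (t - s))) \<partial>lborel)"
        by (cases "integrable lborel (\<lambda>s. ext0 F s * ext0 G (t - s))")
           (auto intro: integral_norm_bound_ennreal simp: not_integrable_integral_eq)
      then have "ennreal (cmod (\<integral>s. ext0 F s * ext0 G (t - s) \<partial>lborel)) * ennreal (weight0 w t) \<le>
         (\<integral>\<^sup>+s. ennreal (cmod (ext0 F s * ext0 G (t - s))) \<partial>lborel) * ennreal (weight0 w t)"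
        by (rule mult_right_mono) simp
      also have "\<dots> = (\<integral>\<^sup>+s. ennreal (cmod (ext0 F s * ext0 G (t - s))) * ennreal (weight0 w t) \<partial>lborel)"
        by (rule nn_integral_multc[symmetric]) measurable
      also have "\<dots> \<le> (\<integral>\<^sup>+s. ?f s * ?g (t - s) \<partial>lborel)"
      proof (rule nn_integral_mono)
        fix s :: real
        show "ennreal (cmod (ext0 F s * ext0 G (t - s))) * ennreal (weight0 w t) \<le> ?f s * ?g (t - s)"
        proof (cases "0 \<le> s \<and> 0 \<le> t - s")
          case True
          then have "w (s + (t - s)) \<le> w s * w (t - s)"
            using w unfolding algebra_weight_def by blast
          with True have "weight0 w t \<le> weight0 w s * weight0 w (t - s)"
            by (simp add: weight0_def)
          then have "ennreal (weight0 w t) \<le> ennreal (weight0 w s) * ennreal (weight0 w (t - s))"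
            using weight0_nonneg[OF w] by (simp add: ennreal_mult[symmetric])
          then have "ennreal (cmod (ext0 F s)) * ennreal (cmod (ext0 G (t - s))) * ennreal (weight0 w t) \<le>
            ennreal (cmod (ext0 F s)) * ennreal (cmod (ext0 G (t - s))) * (ennreal (weight0 w s) * ennreal (weight0 w (t - s)))"
            by (rule mult_left_mono) simp
          then show ?thesis
            by (simp add: norm_mult ennreal_mult ac_simps)
        qed (auto simp: ext0_neg not_le)
      qed
      finally show ?thesis .
    qed
    show "AE t in lborel. ennreal (cmod (ext0 (F \<star> G) t)) * ennreal (weight0 w t) \<le>
       (\<integral>\<^sup>+s. ?f s * ?g (t - s) \<partial>lborel)"
      using AE_ext0_convolution[of F G] le by (auto elim!: eventually_mono)
  qed
  also have "\<dots> = wnorm w F * wnorm w G"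
    unfolding wnorm_ext0 by (rule nn_integral_convolution) measurable
  finally show ?thesis .
qed

text \<open>If w(t) < 1, submultiplicativity keeps w(n t) \<le> 1 for all n, although n t and
  therefore w(n t) tends to infinity.\<close>

lemma one_le_weight:
  assumes w: "algebra_weight w" and lim: "filterlim w at_top at_top" and t: "0 \<le> t"
  shows "1 \<le> w t"
proof (rule ccontr)
  assume less: "\<not> 1 \<le> w t"
  have sub: "\<And>s t. 0 \<le> s \<Longrightarrow> 0 \<le> t \<Longrightarrow> w (s + t) \<le> w s * w t" and w0: "w 0 = 1"
    and pos: "\<And>t. 0 \<le> t \<Longrightarrow> 0 < w t"
    using w by (auto simp: algebra_weight_def)
  have t0: "0 < t"
    using less w0 t by (cases "t = 0") auto
  have le: "w (real n * t) \<le> 1" for n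
  proof (induction n)
    case (Suc n)
    have "w (real (Suc n) * t) \<le> w (real n * t) * w t"
      using sub[of "real n * t" t] t by (simp add: algebra_simps)
    also have "\<dots> \<le> 1 * 1"
      using Suc less pos[of t] t by (intro mult_mono) auto
    finally show ?case by simp
  qed (simp add: w0)
  have "filterlim (\<lambda>n. real n * t) at_top sequentially"
    by (rule filterlim_at_top_mult_tendsto_pos[OF tendsto_const t0 filterlim_real_sequentially])
  then have "filterlim (\<lambda>n. w (real n * t)) at_top sequentially"
    by (rule filterlim_compose[OF lim])
  then have "eventually (\<lambda>n. 2 \<le> w (real n * t)) sequentially"
    by (simp add: filterlim_at_top)
  then obtain n where "2 \<le> w (real n * t)"
    by (auto simp: eventually_sequentially)
  with le[of n] show False by simp
qed

section \<open>Laplace transforms as characters\<close>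

definition laplace :: "nat \<Rightarrow> halfline_fun \<Rightarrow> complex" where
  "laplace k F = (\<integral>t. of_real (exp (- (real k * t))) * ext0 F t \<partial>lborel)"

lemma L1w_integrable:
  assumes w: "algebra_weight w" and F: "F \<in> L1w w"
  shows "integrable lborel (\<lambda>t. of_real (weight0 w t) * ext0 F t)"
    and "wnorm w F = ennreal (\<integral>t. cmod (of_real (weight0 w t) * ext0 F t) \<partial>lborel)"
proof -
  note [measurable] = weight0_measurable[OF w]
  have eq: "wnorm w F = (\<integral>\<^sup>+t. ennreal (cmod (of_real (weight0 w t) * ext0 F t)) \<partial>lborel)"
    unfolding wnorm_ext0 using weight0_nonneg[OF w]
    by (intro nn_integral_cong) (simp add: norm_mult ennreal_mult ac_simps)
  show int: "integrable lborel (\<lambda>t. of_real (weight0 w t) * ext0 F t)"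
  proof (rule integrableI_bounded)
    show "(\<integral>\<^sup>+t. ennreal (cmod (of_real (weight0 w t) * ext0 F t)) \<partial>lborel) < \<infinity>"
      using F unfolding eq[symmetric] by (simp add: L1w_def)
  qed measurable
  then show "wnorm w F = ennreal (\<integral>t. cmod (of_real (weight0 w t) * ext0 F t) \<partial>lborel)"
    unfolding eq by (intro nn_integral_eq_integral) auto
qed

context
  fixes w :: "real \<Rightarrow> real"
  assumes w: "algebra_weight w" and one_le: "\<And>t. 0 \<le> t \<Longrightarrow> 1 \<le> w t"
begin

text \<open>On the half-line exp(-k t) \<le> 1 \<le> w(t), so the weight dominates the
  kernel.\<close>

lemma integrable_laplace:
  assumes F: "F \<in> L1w w"
  shows "integrable lborel (\<lambda>t. of_real (exp (- (real k * t))) * ext0 F t)"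
    and "cmod (laplace k F) \<le> enn2real (wnorm w F)"
proof -
  have bound: "norm (of_real (exp (- (real k * t))) * ext0 F t) \<le> norm (of_real (weight0 w t) * ext0 F t)" for t
  proof (cases "t < 0")
    case False
    then have "exp (- (real k * t)) \<le> 1" by simp
    also have "1 \<le> w t" using False one_le by simp
    finally have "exp (- (real k * t)) \<le> \<bar>weight0 w t\<bar>" using False by (simp add: weight0_def)
    then show ?thesis
      by (simp add: norm_mult mult_right_mono)
  qed (simp add: ext0_neg)
  show int: "integrable lborel (\<lambda>t. of_real (exp (- (real k * t))) * ext0 F t)"
    by (rule Bochner_Integration.integrable_bound[OF L1w_integrable(1)[OF w F]]) (use bound in simp_all)
  have "cmod (laplace k F) \<le> (\<integral>t. norm (of_real (exp (- (real k * t))) * ext0 F t) \<partial>lborel)"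
    unfolding laplace_def by (rule integral_norm_bound)
  also have "\<dots> \<le> (\<integral>t. norm (of_real (weight0 w t) * ext0 F t) \<partial>lborel)"
    using int L1w_integrable(1)[OF w F] bound by (intro integral_mono integrable_norm)
  also have "\<dots> = enn2real (wnorm w F)"
    by (simp add: L1w_integrable(2)[OF w F])
  finally show "cmod (laplace k F) \<le> enn2real (wnorm w F)" .
qed

lemma laplace_add:
  assumes "F \<in> L1w w" "G \<in> L1w w"
  shows "laplace k (F + G) = laplace k F + laplace k G"
proof -
  have "laplace k (F + G) = (\<integral>t. of_real (exp (- (real k * t))) * ext0 F t + of_real (exp (- (real k * t))) * ext0 G t \<partial>lborel)"
    unfolding laplace_def using AE_ext0_add[of F G]
    by (intro integral_cong_AE) (auto simp: distrib_left elim: eventually_mono)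
  then show ?thesis
    using integrable_laplace(1)[OF assms(1)] integrable_laplace(1)[OF assms(2)] by (simp add: laplace_def)
qed

lemma laplace_convolution:
  assumes "F \<in> L1w w" "G \<in> L1w w"
  shows "laplace k (F \<star> G) = laplace k F * laplace k G"
proof -
  let ?e = "\<lambda>t. complex_of_real (exp (- (real k * t)))"
  have "laplace k (F \<star> G) = (\<integral>t. ?e t * (\<integral>s. ext0 F s * ext0 G (t - s) \<partial>lborel) \<partial>lborel)"
    unfolding laplace_def using AE_ext0_convolution[of F G]
    by (intro integral_cong_AE) (auto elim: eventually_mono)
  also have "\<dots> = (\<integral>t. \<integral>s. (?e s * ext0 F s) * (?e (t - s) * ext0 G (t - s)) \<partial>lborel \<partial>lborel)"
  proof (rule Bochner_Integration.integral_cong[OF refl])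
    fix t :: real
    \<comment> \<open>Multiplicativity of the exponential distributes the kernel over the two
      factors, which makes the transform multiplicative.\<close>
    have "?e t = ?e s * ?e (t - s)" for s
      by (simp add: of_real_mult[symmetric] exp_add[symmetric] algebra_simps del: of_real_mult)
    then have "(?e s * ext0 F s) * (?e (t - s) * ext0 G (t - s)) = ?e t * (ext0 F s * ext0 G (t - s))" for s
      by (simp add: ac_simps)
    then show "?e t * (\<integral>s. ext0 F s * ext0 G (t - s) \<partial>lborel) =
        (\<integral>s. (?e s * ext0 F s) * (?e (t - s) * ext0 G (t - s)) \<partial>lborel)"
      by (simp only: integral_mult_right_zero)
  qed
  also have "\<dots> = laplace k F * laplace k G"
    unfolding laplace_def by (intro integral_convolution integrable_laplace(1) assms)
  finally show ?thesis .
qed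

lemma eq_0_if_laplace_eq_0:
  assumes F: "F \<in> L1w w" and 0: "\<And>k. laplace k F = 0"
  shows "F = 0"
  \<comment> \<open>At \<open>k = 0\<close> the kernel is 1, so this is integrability of
    \<open>ext0 F\<close> itself.\<close>
  using integrable_laplace(1)[OF F, of 0] 0
  by (intro eq_0_if_AE_ext0_eq_0 Lerch) (auto simp: ext0_neg laplace_def)

end

lemma laplace_cscale: "laplace k (cscale c F) = c * laplace k F"
proof -
  have "laplace k (cscale c F) = (\<integral>t. c * (of_real (exp (- (real k * t))) * ext0 F t) \<partial>lborel)"
    unfolding laplace_def using AE_ext0_cscale[of c F]
    by (intro integral_cong_AE) (auto elim: eventually_mono)
  then show ?thesis
    by (simp add: laplace_def)
qed

section \<open>Weak topologies and weak boundedness\<close>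

lemma topspace_weak_topology: "topspace (weak_topology sc X) = topspace X"
proof -
  have "(\<lambda>_. 0) \<in> topological_dual sc X"
    by (simp add: topological_dual_def linear_map_on_def)
  then have "topspace X \<in> {{x \<in> topspace X. \<phi> x \<in> V} |\<phi> V. \<phi> \<in> topological_dual sc X \<and> open V}"
    by (intro CollectI exI[of _ "\<lambda>_. 0"] exI[of _ UNIV]) auto
  then show ?thesis
    unfolding weak_topology_def topology_generated_by_topspace by blast
qed

lemma continuous_map_weak_topology:
  assumes "\<phi> \<in> topological_dual sc X"
  shows "continuous_map (weak_topology sc X) euclidean \<phi>"
  unfolding continuous_map_def topspace_weak_topology
proof (intro conjI allI impI)
  fix V :: "complex set" assume "openin euclidean V"
  then show "openin (weak_topology sc X) {x \<in> topspace X. \<phi> x \<in> V}"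
    unfolding weak_topology_def using assms by (intro topology_generated_by_Basis) auto
qed auto

text \<open>A functional of the dual is weakly continuous, so it maps the compact weak closure to a
  compact set of complex numbers.\<close>

lemma bounded_image_if_weakly_relatively_compact:
  assumes "compactin (weak_topology sc X) (weak_topology sc X closure_of S)"
    and "S \<subseteq> topspace X" and "\<phi> \<in> topological_dual sc X"
  shows "bounded (\<phi> ` S)"
proof -
  have "compactin euclidean (\<phi> ` (weak_topology sc X closure_of S))"
    by (rule image_compactin[OF assms(1) continuous_map_weak_topology[OF assms(3)]])
  moreover have "S \<subseteq> weak_topology sc X closure_of S"
    using assms(2) by (intro closure_of_subset) (simp add: topspace_weak_topology)
  ultimately show ?thesis
    by (meson bounded_subset compactin_euclidean_iff compact_imp_bounded image_mono)
qed

section \<open>The algebra \<open>Aw \<omega>\<close>, its topology and its norms\<close>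

locale weight_sequence =
  fixes \<omega> :: "nat \<Rightarrow> real \<Rightarrow> real"
  assumes weight: "\<And>n. algebra_weight (\<omega> n)"
    and increasing: "\<And>n t. 0 \<le> t \<Longrightarrow> \<omega> n t \<le> \<omega> (Suc n) t"
begin

lemma Aw_iff: "F \<in> Aw \<omega> \<longleftrightarrow> (\<forall>n. wnorm (\<omega> n) F < \<infinity>)"
  by (simp add: Aw_def L1w_def)

lemma Aw_L1w: "F \<in> Aw \<omega> \<Longrightarrow> F \<in> L1w (\<omega> n)"
  by (simp add: Aw_def)

lemma Aw_add: "F \<in> Aw \<omega> \<Longrightarrow> G \<in> Aw \<omega> \<Longrightarrow> F + G \<in> Aw \<omega>"
  unfolding Aw_iff
  by (metis ennreal_add_less_top order_le_less_trans infinity_ennreal_def wnorm_add[OF weight])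

lemma Aw_uminus: "F \<in> Aw \<omega> \<Longrightarrow> - F \<in> Aw \<omega>"
  by (simp add: Aw_iff wnorm_uminus)

lemma Aw_diff: "F \<in> Aw \<omega> \<Longrightarrow> G \<in> Aw \<omega> \<Longrightarrow> F - G \<in> Aw \<omega>"
  using Aw_add[of F "- G"] Aw_uminus[of G] by simp

lemma Aw_cscale: "F \<in> Aw \<omega> \<Longrightarrow> cscale c F \<in> Aw \<omega>"
  by (simp add: Aw_iff wnorm_cscale[OF weight] ennreal_mult_less_top)

lemma Aw_convolution: "F \<in> Aw \<omega> \<Longrightarrow> G \<in> Aw \<omega> \<Longrightarrow> F \<star> G \<in> Aw \<omega>"
  unfolding Aw_iff
  by (metis ennreal_mult_less_top order_le_less_trans infinity_ennreal_def wnorm_convolution[OF weight])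

lemma Aw_zero: "0 \<in> Aw \<omega>"
  by (simp add: Aw_iff wnorm_zero)

lemma wnorm_mono:
  assumes "m \<le> n"
  shows "wnorm (\<omega> m) F \<le> wnorm (\<omega> n) F"
proof -
  have "\<omega> m t \<le> \<omega> n t" if "0 \<le> t" for t
    by (rule lift_Suc_mono_le[where f = "\<lambda>n. \<omega> n t"]) (use increasing that assms in auto)
  then have "weight0 (\<omega> m) t \<le> weight0 (\<omega> n) t" for t
    by (simp add: weight0_def indicator_def)
  then show ?thesis
    unfolding wnorm_ext0 by (intro nn_integral_mono mult_left_mono ennreal_leI) auto
qed

lemma topspace_Aw_topology: "topspace (Aw_topology \<omega>) = Aw \<omega>"
proof -
  have "F \<in> \<Union> {{G \<in> Aw \<omega>. wnorm (\<omega> n) (G - F) < ennreal e} | n F e. F \<in> Aw \<omega> \<and> 0 < e}"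
    if "F \<in> Aw \<omega>" for F
    using that
    by (intro UnionI[of "{G \<in> Aw \<omega>. wnorm (\<omega> 0) (G - F) < ennreal 1}"] CollectI exI[of _ "0::nat"] exI[of _ F] exI[of _ "1::real"])
       (auto simp: wnorm_zero)
  then show ?thesis
    unfolding Aw_topology_def topology_generated_by_topspace by auto
qed

lemma openin_Aw_topology_ball:
  assumes "F \<in> Aw \<omega>" "0 < e"
  shows "openin (Aw_topology \<omega>) {G \<in> Aw \<omega>. wnorm (\<omega> n) (G - F) < ennreal e}"
  unfolding Aw_topology_def using assms by (intro topology_generated_by_Basis) auto

text \<open>Induction over the generation of the topology. Because the norms increase, two balls
  about 0 contain a common ball of the norm with the larger index, so one norm suffices.\<close>

lemma open_nbhd_zero_contains_ball:
  assumes "openin (Aw_topology \<omega>) U" "0 \<in> U"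
  shows "\<exists>m e. 0 < e \<and> (\<forall>F\<in>Aw \<omega>. wnorm (\<omega> m) F < ennreal e \<longrightarrow> F \<in> U)"
  using assms unfolding Aw_topology_def openin_topology_generated_by_iff
proof (induction rule: generate_topology_on.induct)
  case (Int a b)
  then obtain m e m' e' where
    a: "0 < e" "\<And>F. F \<in> Aw \<omega> \<Longrightarrow> wnorm (\<omega> m) F < ennreal e \<Longrightarrow> F \<in> a" and
    b: "0 < e'" "\<And>F. F \<in> Aw \<omega> \<Longrightarrow> wnorm (\<omega> m') F < ennreal e' \<Longrightarrow> F \<in> b"
    by fastforce
  have "F \<in> a \<inter> b" if F: "F \<in> Aw \<omega>" and less: "wnorm (\<omega> (max m m')) F < ennreal (min e e')" for F
  proof -
    have "ennreal (min e e') \<le> ennreal e" "ennreal (min e e') \<le> ennreal e'"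
      by (simp_all add: ennreal_leI)
    with less have "wnorm (\<omega> m) F < ennreal e" "wnorm (\<omega> m') F < ennreal e'"
      using wnorm_mono[of m "max m m'" F] wnorm_mono[of m' "max m m'" F]
      by (meson max.cobounded1 max.cobounded2 order_le_less_trans order_less_le_trans)+
    with F show ?thesis using a b by auto
  qed
  then show ?case
    using a(1) b(1) by (intro exI[of _ "max m m'"] exI[of _ "min e e'"]) auto
next
  case (UN K)
  then obtain k where k: "k \<in> K" "0 \<in> k" by auto
  with UN.IH[OF k] show ?case by (meson UnionI)
next
  case (Basis s)
  then obtain n F e where s: "s = {G \<in> Aw \<omega>. wnorm (\<omega> n) (G - F) < ennreal e}" and F: "F \<in> Aw \<omega>" "0 < e"
    by auto
  have Fe: "wnorm (\<omega> n) F < ennreal e"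
    using Basis(2) unfolding s by (simp add: wnorm_uminus)
  \<comment> \<open>Since 0 lies in the ball of radius \<open>e\<close> about \<open>F\<close>, the
    norm \<open>r\<close> of \<open>F\<close> is below \<open>e\<close>; by the triangle inequality
    the ball of radius \<open>e - r\<close> about 0 fits inside.\<close>
  then obtain r where r: "0 \<le> r" "wnorm (\<omega> n) F = ennreal r"
    by (cases "wnorm (\<omega> n) F") auto
  have "G \<in> s" if G: "G \<in> Aw \<omega>" and less: "wnorm (\<omega> n) G < ennreal (e - r)" for G
  proof -
    have "wnorm (\<omega> n) (G - F) \<le> wnorm (\<omega> n) G + wnorm (\<omega> n) F"
      using wnorm_add[OF weight, of n G "- F"] by (simp add: wnorm_uminus)
    also have "\<dots> < ennreal (e - r) + ennreal r"
      unfolding r(2) using less by (simp add: add.commute[of _ "ennreal r"] ennreal_add_left_cancel_less)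
    also have "\<dots> = ennreal e"
      using r Fe by (subst ennreal_plus[symmetric]) (auto simp: ennreal_less_iff)
    finally show ?thesis using G by (simp add: s)
  qed
  moreover have "0 < e - r"
    using Fe r by (simp add: ennreal_less_iff)
  ultimately show ?case by blast
qed simp

text \<open>The real-valued norm; \<open>enn2real\<close> gives 0 at infinity, so it reflects
  \<open>wnorm\<close> faithfully only where that is finite, in particular on
  \<open>Aw \<omega>\<close>.\<close>

definition seminorm :: "nat \<Rightarrow> halfline_fun \<Rightarrow> real" where
  "seminorm n F = enn2real (wnorm (\<omega> n) F)"

lemma ennreal_seminorm: "F \<in> Aw \<omega> \<Longrightarrow> wnorm (\<omega> n) F = ennreal (seminorm n F)"
  by (simp add: seminorm_def Aw_iff)

lemma seminorm_nonneg: "0 \<le> seminorm n F"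
  by (simp add: seminorm_def)

lemma seminorm_cscale: "seminorm n (cscale c F) = cmod c * seminorm n F"
  by (simp add: seminorm_def wnorm_cscale[OF weight] enn2real_mult)

lemma seminorm_convolution: "F \<in> Aw \<omega> \<Longrightarrow> G \<in> Aw \<omega> \<Longrightarrow> seminorm n (F \<star> G) \<le> seminorm n F * seminorm n G"
  using wnorm_convolution[OF weight, of n F G]
  by (simp add: ennreal_seminorm Aw_convolution seminorm_nonneg ennreal_mult[symmetric])

text \<open>Multiplication by the weight carries the norm with index \<open>n\<close> to the plain
  integral norm; \<open>pairing n h\<close> is the functional given there by a bounded function
  \<open>h\<close>.\<close>

definition pairing :: "nat \<Rightarrow> (real \<Rightarrow> complex) \<Rightarrow> halfline_fun \<Rightarrow> complex" where
  "pairing n h F = (\<integral>t. h t * (of_real (weight0 (\<omega> n) t) * ext0 F t) \<partial>lborel)"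

lemma pairing_in_dual:
  assumes hm: "h \<in> borel_measurable lborel" and h1: "\<And>t. cmod (h t) \<le> 1"
  shows "pairing n h \<in> topological_dual cscale (Aw_topology \<omega>)"
proof -
  note [measurable] = hm weight0_measurable[OF weight]
  have bound: "cmod (h t * z) \<le> cmod z" for t z
    using h1[of t] by (simp add: norm_mult mult_left_le_one_le)
  have int: "integrable lborel (\<lambda>t. h t * (of_real (weight0 (\<omega> n) t) * ext0 F t))" if "F \<in> Aw \<omega>" for F
  proof (rule Bochner_Integration.integrable_bound[OF L1w_integrable(1)[OF weight Aw_L1w[OF that]]])
    show "(\<lambda>t. h t * (of_real (weight0 (\<omega> n) t) * ext0 F t)) \<in> borel_measurable lborel"
      by measurable
    show "AE t in lborel. norm (h t * (of_real (weight0 (\<omega> n) t) * ext0 F t))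
       \<le> norm (of_real (weight0 (\<omega> n) t) * ext0 F t)"
      using bound by simp
  qed
  have add: "pairing n h (F + G) = pairing n h F + pairing n h G" if "F \<in> Aw \<omega>" "G \<in> Aw \<omega>" for F G
  proof -
    have "pairing n h (F + G) = (\<integral>t. h t * (of_real (weight0 (\<omega> n) t) * ext0 F t) +
        h t * (of_real (weight0 (\<omega> n) t) * ext0 G t) \<partial>lborel)"
      unfolding pairing_def using AE_ext0_add[of F G]
      by (intro integral_cong_AE) (auto simp: distrib_left elim: eventually_mono)
    then show ?thesis
      using int[OF that(1)] int[OF that(2)] by (simp add: pairing_def)
  qed
  have scale: "pairing n h (cscale c F) = c * pairing n h F" for c F
  proof -
    have "pairing n h (cscale c F) = (\<integral>t. c * (h t * (of_real (weight0 (\<omega> n) t) * ext0 F t)) \<partial>lborel)"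
      unfolding pairing_def using AE_ext0_cscale[of c F]
      by (intro integral_cong_AE) (auto elim: eventually_mono)
    then show ?thesis
      by (simp add: pairing_def)
  qed
  have le: "ennreal (cmod (pairing n h F)) \<le> wnorm (\<omega> n) F" if F: "F \<in> Aw \<omega>" for F
  proof -
    have "cmod (pairing n h F) \<le> (\<integral>t. cmod (h t * (of_real (weight0 (\<omega> n) t) * ext0 F t)) \<partial>lborel)"
      unfolding pairing_def by (rule integral_norm_bound)
    also have "\<dots> \<le> (\<integral>t. cmod (of_real (weight0 (\<omega> n) t) * ext0 F t) \<partial>lborel)"
      using int[OF F] L1w_integrable(1)[OF weight Aw_L1w[OF F]] bound by (intro integral_mono integrable_norm)
    finally show ?thesis
      unfolding L1w_integrable(2)[OF weight Aw_L1w[OF F]] by (rule ennreal_leI)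
  qed
  have "continuous_map (Aw_topology \<omega>) euclidean (pairing n h)"
    unfolding continuous_map_def topspace_Aw_topology
  proof (intro conjI allI impI)
    fix V :: "complex set" assume "openin euclidean V"
    then have V: "open V" by simp
    show "openin (Aw_topology \<omega>) {F \<in> Aw \<omega>. pairing n h F \<in> V}"
    proof (subst openin_subopen, intro ballI)
      fix F assume F: "F \<in> {F \<in> Aw \<omega>. pairing n h F \<in> V}"
      then obtain e where e: "0 < e" "ball (pairing n h F) e \<subseteq> V"
        using V open_contains_ball by blast
      have "pairing n h G \<in> V" if G: "G \<in> Aw \<omega>" and less: "wnorm (\<omega> n) (G - F) < ennreal e" for G
      proof -
        have GF: "G - F \<in> Aw \<omega>" using F G by (auto intro: Aw_diff)
        have "ennreal (cmod (pairing n h (G - F))) < ennreal e"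
          using le[OF GF] less by (rule order_le_less_trans)
        then have "cmod (pairing n h (G - F)) < e"
          by (simp add: ennreal_less_iff)
        moreover have "pairing n h G = pairing n h (G - F) + pairing n h F"
          using add[OF GF, of F] F by simp
        ultimately have "pairing n h G \<in> ball (pairing n h F) e"
          by (simp add: dist_norm norm_minus_commute)
        with e show ?thesis by auto
      qed
      then show "\<exists>T. openin (Aw_topology \<omega>) T \<and> F \<in> T \<and> T \<subseteq> {F \<in> Aw \<omega>. pairing n h F \<in> V}"
        using F e openin_Aw_topology_ball[of F e n]
        by (intro exI[of _ "{G \<in> Aw \<omega>. wnorm (\<omega> n) (G - F) < ennreal e}"]) (auto simp: wnorm_zero)
    qed
  qed auto
  then show ?thesis
    using add scale by (simp add: topological_dual_def linear_map_on_def topspace_Aw_topology)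
qed

text \<open>The pairings bound the integrals of the weighted functions against every bounded
  \<open>h\<close>, and the uniform boundedness principle turns this into a bound in norm.\<close>

lemma seminorm_bounded_if_weakly_relatively_compact:
  assumes comp: "compactin (weak_topology cscale (Aw_topology \<omega>)) (weak_topology cscale (Aw_topology \<omega>) closure_of S)"
    and S: "S \<subseteq> Aw \<omega>"
  shows "\<exists>C. \<forall>F\<in>S. seminorm n F \<le> C"
proof -
  let ?g = "\<lambda>F t. of_real (weight0 (\<omega> n) t) * ext0 F t"
  have "\<exists>C. \<forall>f\<in>?g ` S. (\<integral>t. cmod (f t) \<partial>lborel) \<le> C"
  proof (rule L1_bounded_if_weakly_bounded)
    show "integrable lborel f" if "f \<in> ?g ` S" for f
      using that S by (auto intro!: L1w_integrable(1) weight Aw_L1w)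
    show "bounded ((\<lambda>f. \<integral>t. h t * f t \<partial>lborel) ` ?g ` S)"
      if "h \<in> borel_measurable lborel" "\<And>t. cmod (h t) \<le> 1" for h
      using bounded_image_if_weakly_relatively_compact[OF comp _ pairing_in_dual[OF that, of n]] S
      by (simp add: image_image pairing_def topspace_Aw_topology)
  qed
  then obtain C where C: "\<And>F. F \<in> S \<Longrightarrow> (\<integral>t. cmod (?g F t) \<partial>lborel) \<le> C"
    by auto
  have "seminorm n F \<le> C" if "F \<in> S" for F
    using C[OF that] L1w_integrable(2)[OF weight Aw_L1w, of F n] S that
    by (auto simp: seminorm_def)
  then show ?thesis by blast
qed

text \<open>The image of the neighbourhood is bounded in every norm, hence also in the very norm
  \<open>m\<close> whose ball lies in the neighbourhood. This is why the same \<open>m\<close>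
  stands on both sides.\<close>

lemma weakly_compact_map_seminorm_bound:
  assumes wc: "weakly_compact_map (Aw_topology \<omega>) cscale (Aw_topology \<omega>) D"
    and maps: "D ` Aw \<omega> \<subseteq> Aw \<omega>" and lin: "linear_map_on cscale cscale (Aw \<omega>) D"
  shows "\<exists>m K. 0 \<le> K \<and> (\<forall>F\<in>Aw \<omega>. seminorm m (D F) \<le> K * seminorm m F)"
proof -
  obtain N U where U: "openin (Aw_topology \<omega>) U" "0 \<in> U" "U \<subseteq> N" and N: "N \<subseteq> Aw \<omega>"
    and comp: "compactin (weak_topology cscale (Aw_topology \<omega>)) (weak_topology cscale (Aw_topology \<omega>) closure_of (D ` N))"
    using wc by (auto simp: weakly_compact_map_def topspace_Aw_topology)
  obtain m e where e: "0 < e" and ball: "\<And>F. F \<in> Aw \<omega> \<Longrightarrow> wnorm (\<omega> m) F < ennreal e \<Longrightarrow> F \<in> N"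
    using open_nbhd_zero_contains_ball[OF U(1,2)] U(3) by blast
  obtain C where C: "\<And>F. F \<in> N \<Longrightarrow> seminorm m (D F) \<le> C"
    using seminorm_bounded_if_weakly_relatively_compact[OF comp, of m] maps N by blast
  have D_cscale: "D (cscale c F) = cscale c (D F)" if "F \<in> Aw \<omega>" for c F
    using lin that by (simp add: linear_map_on_def)
  have scaled: "r * seminorm m (D F) \<le> C" if F: "F \<in> Aw \<omega>" and r: "0 \<le> r" "r * seminorm m F < e" for F r
  proof -
    have "cscale (of_real r) F \<in> N"
      using F r Aw_cscale[OF F, of "of_real r"]
      by (intro ball) (simp_all add: ennreal_seminorm seminorm_cscale ennreal_less_iff seminorm_nonneg)
    from C[OF this] show ?thesis
      using F r by (simp add: D_cscale seminorm_cscale)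
  qed
  have C0: "0 \<le> C"
    using scaled[OF Aw_zero, of 0] e by simp
  have "seminorm m (D F) \<le> (2 * C / e) * seminorm m F" if F: "F \<in> Aw \<omega>" for F
  proof (cases "seminorm m F = 0")
    case True
    have "seminorm m (D F) = 0"
    proof (rule ccontr)
      assume "seminorm m (D F) \<noteq> 0"
      then have "0 < seminorm m (D F)"
        using seminorm_nonneg[of m "D F"] by simp
      then show False
        \<comment> \<open>If the norm of \<open>F\<close> is 0, all multiples of \<open>F\<close>
          stay in the ball; this multiple would give C + 1 \<le> C.\<close>
        using scaled[OF F, of "(C + 1) / seminorm m (D F)"] True e C0 by simp
    qed
    with True show ?thesis by simp
  next
    case False
    then have pos: "0 < seminorm m F"
      using seminorm_nonneg[of m F] by simp
    \<comment> \<open>This factor scales \<open>F\<close> to norm e / 2, strictly inside the ball of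
      radius \<open>e\<close>.\<close>
    have "e / (2 * seminorm m F) * seminorm m (D F) \<le> C"
      using pos e by (intro scaled[OF F]) auto
    then show ?thesis
      using pos e by (simp add: field_simps)
  qed
  then show ?thesis
    using C0 e by (intro exI[of _ m] exI[of _ "2 * C / e"]) auto
qed

end

section \<open>Weakly compact derivations vanish\<close>

theorem theorem4p3:
  fixes \<omega> :: "nat \<Rightarrow> real \<Rightarrow> real"
  assumes weight: "\<And>n. algebra_weight (\<omega> n)"
    and increasing: "\<And>n t. 0 \<le> t \<Longrightarrow> \<omega> n t \<le> \<omega> (Suc n) t"
    and to_infinity: "\<And>n. filterlim (\<omega> n) at_top at_top"
    and root_limit: "\<And>n. ((\<lambda>t. \<omega> n t powr (1 / t)) \<longlongrightarrow> 1) at_top"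
    and sup_infinite: "\<And>n. (SUP t\<in>{0..}. ereal (\<omega> (Suc n) t / \<omega> n t)) = \<infinity>"
  shows "\<not> (\<exists>D. derivation_on (Aw \<omega>) D \<and>
                weakly_compact_map (Aw_topology \<omega>) cscale (Aw_topology \<omega>) D \<and>
                (\<exists>F\<in>Aw \<omega>. D F \<noteq> 0))"
proof (intro notI, elim exE conjE bexE)
  fix D F
  assume der: "derivation_on (Aw \<omega>) D" and wc: "weakly_compact_map (Aw_topology \<omega>) cscale (Aw_topology \<omega>) D"
    and F: "F \<in> Aw \<omega>" and DF: "D F \<noteq> 0"
  interpret weight_sequence \<omega>
    by unfold_locales (fact weight increasing)+
  have maps: "D ` Aw \<omega> \<subseteq> Aw \<omega>" and lin: "linear_map_on cscale cscale (Aw \<omega>) D"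
    using der by (auto simp: derivation_on_def)
  obtain m K where K: "0 \<le> K" and bound: "\<And>F. F \<in> Aw \<omega> \<Longrightarrow> seminorm m (D F) \<le> K * seminorm m F"
    using weakly_compact_map_seminorm_bound[OF wc maps lin] by blast
  have one_le: "1 \<le> \<omega> m t" if "0 \<le> t" for t
    using one_le_weight[OF weight to_infinity that] .
  have "laplace k (D F) = 0" for k
  proof -
    \<comment> \<open>The single norm \<open>m\<close> in which \<open>D\<close> is bounded is kept
      for all \<open>k\<close>; it also dominates each \<open>laplace k\<close>, because
      \<open>\<omega> m\<close> is at least 1 on the half-line.\<close>
    interpret bounded_derivation_character "Aw \<omega>" convolution cscale "seminorm m" D K "laplace k"
    proof
      fix x y c
      assume x: "x \<in> Aw \<omega>"
      show "cscale c x \<in> Aw \<omega>" "D x \<in> Aw \<omega>" "D (cscale c x) = cscale c (D x)"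
        "seminorm m (D x) \<le> K * seminorm m x"
        "laplace k (cscale c x) = c * laplace k x"
        using x maps lin bound by (auto simp: Aw_cscale linear_map_on_def laplace_cscale)
      show "cmod (laplace k x) \<le> seminorm m x"
        unfolding seminorm_def using x by (intro integrable_laplace(2) weight one_le Aw_L1w)
      assume y: "y \<in> Aw \<omega>"
      show "x + y \<in> Aw \<omega>" "x \<star> y \<in> Aw \<omega>" "D (x + y) = D x + D y" "D (x \<star> y) = D x \<star> y + x \<star> D y"
        "seminorm m (x \<star> y) \<le> seminorm m x * seminorm m y"
        using x y lin der by (auto simp: Aw_add Aw_convolution linear_map_on_def derivation_on_def seminorm_convolution)
      show "laplace k (x + y) = laplace k x + laplace k y"
        using x y by (intro laplace_add[OF weight one_le] Aw_L1w)
      show "laplace k (x \<star> y) = laplace k x * laplace k y"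
        using x y by (intro laplace_convolution[OF weight one_le] Aw_L1w)
    qed (use K seminorm_nonneg in auto)
    show ?thesis by (rule phi_D_eq_0[OF F])
  qed
  moreover have "D F \<in> L1w (\<omega> m)"
    using F maps by (intro Aw_L1w) auto
  ultimately show False
    using DF eq_0_if_laplace_eq_0[OF weight one_le] by blast
qed

end
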